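(* Let $\alpha,\beta>0$ be constants with $$\alpha>26\left(\frac13+\frac\beta2+\sqrt{\frac19+\beta}\right).$$ For $N=2n$, let $W$ be the adjacency matrix of the stochastic block model with two communities of $n$ members each and connection probabilities $p=\frac{\alpha\log N}{N}$ within communities and $q=\frac{\beta\log N}{N}$ between communities. Then, with high probability (i.e. with probability tending to $1$ as $N\to\infty$), the RatioCut semidefinite program with $k=2$ recovers the two underlying communities exactly.
   Context: Stochastic block model: $\{1,\dots,N\}$, $N=2n$, is split into two communities $\Gamma_1,\Gamma_2$ of size $n$. $W=(w_{ij})$ is a symmetric random matrix with entries in $\{0,1\}$, the $w_{ij}$ ($i\le j$) being independent, with $\mathbb{P}(w_{ij}=1)=p$ if $i,j$ belong to the same community and $\mathbb{P}(w_{ij}=1)=q$ if they belong to different communities ($p,q\in[0,1]$, which holds for $N$ large). Let $D=\operatorname{diag}(W1_N)$, $L=D-W$. The RatioCut semidefinite program with $k$ clusters is $$\min_{Z=Z^\top\in\mathbb{R}^{N\times N}}\langle L,Z\rangle\quad\text{s.t.}\quad Z\succeq0,\ Z\ge0\ (\text{entrywise}),\ \operatorname{Tr}(Z)=k,\ Z1_N=1_N.$$ It recovers a partition $\Gamma_1,\dots,\Gamma_k$ exactly if $X_{\mathrm{rcut}}=\sum_{a=1}^k\frac1{|\Gamma_a|}1_{\Gamma_a}1_{\Gamma_a}^\top$ is its unique global minimizer, where $1_{\Gamma_a}$ is the indicator vector of $\Gamma_a$. *)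

theory Defs
  imports "HOL-Probability.Probability" "Jordan_Normal_Form.Matrix"
begin

hide_const (open) Finite_Cartesian_Product.vec Finite_Cartesian_Product.mat
  Finite_Cartesian_Product.row Finite_Cartesian_Product.column Finite_Cartesian_Product.transpose
no_notation Finite_Cartesian_Product.vec_nth (infixl \<open>$\<close> 90)
no_notation Inner_Product.real_inner_class.inner (infixl \<open>\<bullet>\<close> 70)

text \<open>
  The number of vertices varies, so matrices are the carrier-based ones of
  \<open>Jordan_Normal_Form\<close>, and the vertex set is \<open>{..<N}\<close> instead of \<open>{1..N}\<close>.
  Clusters are given by \<open>\<Gamma> :: nat \<Rightarrow> nat set\<close>, read on the indices \<open>1..k\<close>.
\<close>

definition ones_vec :: "nat \<Rightarrow> real vec" where
  "ones_vec N = vec N (\<lambda>_. 1)"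

definition mat_trace :: "real mat \<Rightarrow> real" where
  "mat_trace A = (\<Sum>i<dim_row A. A $$ (i, i))"

definition frobenius_inner :: "real mat \<Rightarrow> real mat \<Rightarrow> real" where
  "frobenius_inner A B = (\<Sum>i<dim_row A. \<Sum>j<dim_col A. A $$ (i, j) * B $$ (i, j))"

definition pos_semidef :: "nat \<Rightarrow> real mat \<Rightarrow> bool" where
  "pos_semidef N A \<longleftrightarrow>
     A \<in> carrier_mat N N \<and> transpose_mat A = A \<and>
     (\<forall>v\<in>carrier_vec N. 0 \<le> v \<bullet> (A *\<^sub>v v))"

definition laplacian :: "nat \<Rightarrow> real mat \<Rightarrow> real mat" where
  "laplacian N W = mat_diag N (\<lambda>i. (W *\<^sub>v ones_vec N) $ i) - W"

definition rcut_feasible :: "nat \<Rightarrow> nat \<Rightarrow> real mat \<Rightarrow> bool" where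
  "rcut_feasible N k Z \<longleftrightarrow>
     Z \<in> carrier_mat N N \<and> transpose_mat Z = Z \<and> pos_semidef N Z \<and>
     (\<forall>i<N. \<forall>j<N. 0 \<le> Z $$ (i, j)) \<and>
     mat_trace Z = real k \<and> Z *\<^sub>v ones_vec N = ones_vec N"

definition X_rcut :: "nat \<Rightarrow> nat \<Rightarrow> (nat \<Rightarrow> nat set) \<Rightarrow> real mat" where
  "X_rcut N k \<Gamma> = mat N N (\<lambda>(i, j).
     \<Sum>a=1..k. 1 / real (card (\<Gamma> a)) * (indicat_real (\<Gamma> a) i * indicat_real (\<Gamma> a) j))"

definition rcut_recovers :: "nat \<Rightarrow> nat \<Rightarrow> real mat \<Rightarrow> (nat \<Rightarrow> nat set) \<Rightarrow> bool" where
  "rcut_recovers N k W \<Gamma> \<longleftrightarrow>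
     (\<forall>Z. is_arg_min (frobenius_inner (laplacian N W)) (rcut_feasible N k) Z \<longleftrightarrow> Z = X_rcut N k \<Gamma>)"

definition two_communities :: "nat \<Rightarrow> (nat \<Rightarrow> nat set) \<Rightarrow> bool" where
  "two_communities n \<Gamma> \<longleftrightarrow>
     \<Gamma> 1 \<union> \<Gamma> 2 = {..<2 * n} \<and> \<Gamma> 1 \<inter> \<Gamma> 2 = {} \<and> card (\<Gamma> 1) = n \<and> card (\<Gamma> 2) = n"

text \<open>
  The diagonal entries \<open>w\<^sub>i\<^sub>i\<close> are included among the independent entries (with
  probability \<open>p\<close>). For \<open>n \<ge> 1\<close> the definition forces \<open>p, q \<in> [0, 1]\<close>.
\<close>

definition stochastic_block_model ::
  "nat \<Rightarrow> (nat \<Rightarrow> nat set) \<Rightarrow> real \<Rightarrow> real \<Rightarrow> 'a measure \<Rightarrow> ('a \<Rightarrow> real mat) \<Rightarrow> bool" where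
  "stochastic_block_model n \<Gamma> p q M W \<longleftrightarrow>
     prob_space M \<and> two_communities n \<Gamma> \<and>
     (\<forall>\<omega>\<in>space M. W \<omega> \<in> carrier_mat (2 * n) (2 * n) \<and> transpose_mat (W \<omega>) = W \<omega> \<and>
        elements_mat (W \<omega>) \<subseteq> {0, 1}) \<and>
     prob_space.indep_vars M (\<lambda>_. borel) (\<lambda>(i, j) \<omega>. W \<omega> $$ (i, j))
       {(i, j). i \<le> j \<and> j < 2 * n} \<and>
     (\<forall>i<2 * n. \<forall>j<2 * n. measure M {\<omega>\<in>space M. W \<omega> $$ (i, j) = 1} =
        (if \<exists>a\<in>{1, 2}. i \<in> \<Gamma> a \<and> j \<in> \<Gamma> a then p else q))"

end

theory Submission
  imports Defs "HOL-Real_Asymp.Real_Asymp"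
begin

text \<open>
  Every feasible \<open>Z\<close> that puts mass \<open>s > 0\<close> on pairs from different communities is worse than
  \<open>X_rcut\<close> as soon as the within-community Laplacians have spectral gap \<open>\<mu>\<close> and all degrees across
  are at most \<open>T\<close> with \<open>4 T < \<mu>\<close>: the edges inside cost at least \<open>2 \<mu> s / n\<close> (write \<open>Z\<close> as a Gram
  matrix), and testing positive semidefiniteness of \<open>Z\<close> on \<open>e\<^sub>i - e\<^sub>j\<close> minus its projection onto the cluster indicators shows
  that the edges across save at most \<open>8 T s / n\<close>.

  Bernstein's inequality gives \<open>T = (\<alpha>/26) log N\<close>; this is where the constant
  \<open>1/3 + \<beta>/2 + sqrt (1/9 + \<beta>)\<close> comes from. For the gap no matrix concentration inequality is needed. Since
  \<open>np = (\<alpha>/2) log N\<close>, a union bound over pairs of sets gives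
  \<open>\<bar>e(S, T) - p |S| |T|\<bar> \<le> \<epsilon> np sqrt (|S| |T|)\<close> for any fixed \<open>\<epsilon> > 0\<close>, a dyadic decomposition of
  vectors turns this into a bound \<open>\<delta> np\<close> on the norm of the centred adjacency matrix with small \<open>\<delta>\<close>, and
  so the gap is essentially the minimum degree, which a scalar Chernoff bound controls.
\<close>

section \<open>Positive semidefinite quadratic forms\<close>

text \<open>The threshold on \<alpha> comes from the outer degrees. Such a degree has mean
  (\<beta>/2) log N and must stay below (\<alpha>/26) log N at all N vertices. With x = \<alpha>/26
  - \<beta>/2 > 0, Bernstein's rate per unit of log N is x^2 / (\<beta> + 2x/3); it beats the union
  bound when it exceeds 1, that is, when x > 1/3 + sqrt (1/9 + \<beta>). The factor 26 makes the
  resulting T smaller than a quarter of the gap.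

  Degrees are only logarithmic, so no step that bounds the centred matrix may lose a factor growing
  with N. This rules out adding up discrepancy bounds over all pairs of dyadic scales, and a union
  bound that pays for sets of very different sizes. Hence two fixed cut-offs: scales at most
  \<open>r\<close> apart, and set sizes within a factor \<kappa>^2. Beyond them only row sums are
  used, which have order np.

  A sum of a symmetric matrix over S x T may contain an entry twice. The discrepancy is therefore
  stated for the strict upper triangle, whose entries are independent; passing back to the symmetric
  matrix costs a factor 2.\<close>

definition quad_form :: "nat \<Rightarrow> (nat \<Rightarrow> nat \<Rightarrow> real) \<Rightarrow> (nat \<Rightarrow> real) \<Rightarrow> real" where
  "quad_form N R x = (\<Sum>i<N. \<Sum>j<N. R i j * x i * x j)"

definition symmetric_on :: "nat \<Rightarrow> (nat \<Rightarrow> nat \<Rightarrow> real) \<Rightarrow> bool" where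
  "symmetric_on N R \<longleftrightarrow> (\<forall>i<N. \<forall>j<N. R i j = R j i)"

lemma symmetric_onD: "symmetric_on N R \<Longrightarrow> i < N \<Longrightarrow> j < N \<Longrightarrow> R i j = R j i"
  by (simp add: symmetric_on_def)

lemma quad_form_perturb:
  assumes m: "m < N" and sym: "symmetric_on N R"
  shows "quad_form N R (\<lambda>i. x i + (if i = m then t else 0)) =
    quad_form N R x + 2 * t * (\<Sum>j<N. R m j * x j) + t\<^sup>2 * R m m"
proof -
  have "quad_form N R (\<lambda>i. x i + (if i = m then t else 0)) =
     (\<Sum>i<N. \<Sum>j<N. R i j * x i * x j + (if j = m then R i j * x i * t else 0)
        + (if i = m then R i j * t * x j else 0) + (if i = m then (if j = m then R i j * t * t else 0) else 0))"
    unfolding quad_form_def by (intro sum.cong refl) (auto simp: algebra_simps)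
  also have "\<dots> = quad_form N R x + (\<Sum>i<N. R i m * x i * t) + (\<Sum>j<N. R m j * t * x j) + R m m * t * t"
  proof -
    have a: "(\<Sum>i<N. \<Sum>j<N. if i = m then R i j * t * x j else 0) = (\<Sum>j<N. R m j * t * x j)"
      using m by (subst sum.swap) (simp add: sum.delta)
    have b: "(\<Sum>i<N. \<Sum>j<N. if i = m then if j = m then R i j * t * t else 0 else 0) = R m m * t * t"
      using m by (subst sum.swap) (simp add: sum.delta)
    show ?thesis
      unfolding sum.distrib a b using m by (simp add: quad_form_def)
  qed
  also have "(\<Sum>i<N. R i m * x i * t) = t * (\<Sum>j<N. R m j * x j)"
    unfolding sum_distrib_left using symmetric_onD[OF sym m] by (intro sum.cong refl) (auto simp: algebra_simps)
  also have "(\<Sum>j<N. R m j * t * x j) = t * (\<Sum>j<N. R m j * x j)"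
    unfolding sum_distrib_left by (intro sum.cong refl) (auto simp: algebra_simps)
  finally show ?thesis by (simp add: power2_eq_square algebra_simps)
qed

lemma quad_form_unit:
  assumes "j < N"
  shows "quad_form N R (\<lambda>i. if i = j then 1 else 0) = R j j"
  using assms by (simp add: quad_form_def if_distrib[of "\<lambda>u. _ * u"] sum.delta cong: if_cong)

text \<open>With a zero pivot the form is affine along direction \<open>m\<close>, so a nonzero
  slope would make it negative. The witness \<open>t\<close> is chosen so that the value at e_j + t
  e_m is exactly -1.\<close>

lemma psd_row_zero:
  assumes sym: "symmetric_on N R"
    and psd: "\<And>x. 0 \<le> quad_form N R x"
    and m: "m < N" "R m m = 0" and j: "j < N"
  shows "R m j = 0"
proof (rule ccontr)
  assume nz: "R m j \<noteq> 0"
  define t where "t = - (R j j + 1) / (2 * R m j)"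
  have "0 \<le> quad_form N R (\<lambda>i. (if i = j then 1 else 0) + (if i = m then t else 0))"
    by (rule psd)
  also have "\<dots> = R j j + 2 * t * (\<Sum>i<N. R m i * (if i = j then 1 else 0))"
    using quad_form_perturb[OF m(1) sym] quad_form_unit[OF j] m by simp
  also have "(\<Sum>i<N. R m i * (if i = j then 1 else 0)) = R m j"
    using j by (simp add: if_distrib[of "\<lambda>u. _ * u"] sum.delta cong: if_cong)
  also have "R j j + 2 * t * R m j = -1"
    using nz by (simp add: t_def field_simps)
  finally show False by simp
qed

text \<open>Symmetric Gaussian elimination, one pivot per step.\<close>

lemma psd_gram_partial:
  assumes sym: "symmetric_on N Z"
    and psd: "\<And>x. 0 \<le> quad_form N Z x"
    and "m \<le> N"
  shows "\<exists>u R. (\<forall>i<N. \<forall>j<N. Z i j = (\<Sum>k<m. u k i * u k j) + R i j) \<and>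
     symmetric_on N R \<and> (\<forall>x. 0 \<le> quad_form N R x) \<and> (\<forall>k<m. \<forall>j<N. R k j = (0::real))"
  using \<open>m \<le> N\<close>
proof (induction m)
  case 0
  show ?case
  proof (rule exI[of _ "\<lambda>_ _. 0"], rule exI[of _ Z], intro conjI)
    show "symmetric_on N Z" by (rule sym)
    show "\<forall>x. 0 \<le> quad_form N Z x" by (intro allI psd)
    show "\<forall>i<N. \<forall>j<N. Z i j = (\<Sum>k<0. 0 * 0) + Z i j" by simp
    show "\<forall>k<0. \<forall>j<N. Z k j = 0" by simp
  qed
next
  case (Suc m)
  obtain u R where uR: "\<forall>i<N. \<forall>j<N. Z i j = (\<Sum>k<m. u k i * u k j) + R i j"
    "symmetric_on N R" "\<forall>x. 0 \<le> quad_form N R x" "\<forall>k<m. \<forall>j<N. R k j = 0"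
    using Suc.IH[OF Suc_leD[OF Suc.prems]] by (elim exE conjE)
  note Z = uR(1)[rule_format] and R = uR(2) uR(3)[rule_format] and R0 = uR(4)[rule_format]
  have m: "m < N" using Suc by simp
  have Rmm: "R m m \<ge> 0" using R(2)[of "\<lambda>i. if i = m then 1 else 0"] quad_form_unit[OF m] by simp
  \<comment> \<open>If the pivot is 0, division by zero gives \<open>v = 0\<close>; nothing is
    subtracted, and \<open>psd_row_zero\<close> shows that row \<open>m\<close> already vanishes.
    One formula thus covers both cases.\<close>
  define v where "v = (\<lambda>j. R m j / sqrt (R m m))"
  define R' where "R' = (\<lambda>i j. R i j - v i * v j)"
  have vv: "v i * v j = R m i * R m j / R m m" for i j
    using Rmm by (simp add: v_def)
  have psd': "0 \<le> quad_form N R' x" for x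
  proof -
    define s where "s = (\<Sum>j<N. R m j * x j)"
    have "quad_form N R' x = quad_form N R x - (\<Sum>i<N. \<Sum>j<N. (R m i * x i) * (R m j * x j)) / R m m"
      unfolding quad_form_def R'_def vv sum_divide_distrib sum_subtractf[symmetric]
      by (intro sum.cong refl) (simp add: algebra_simps)
    also have "(\<Sum>i<N. \<Sum>j<N. (R m i * x i) * (R m j * x j)) = s\<^sup>2"
      unfolding s_def power2_eq_square sum_product ..
    \<comment> \<open>Completing the square: the Schur complement at \<open>x\<close> is the old
      form with coordinate \<open>m\<close> moved to its minimizer, hence nonnegative. For a zero
      pivot both corrections are 0.\<close>
    also have "quad_form N R x - s\<^sup>2 / R m m =
        quad_form N R (\<lambda>i. x i + (if i = m then - s / R m m else 0))"
      using quad_form_perturb[where x=x and t="- s / R m m", OF m R(1)] unfolding s_def[symmetric]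
      by (cases "R m m = 0") (simp_all add: power2_eq_square field_simps)
    also have "\<dots> \<ge> 0" by (rule R(2))
    finally show ?thesis .
  qed
  have zero: "R' k j = 0" if "k < Suc m" "j < N" for k j
  proof (cases "k = m")
    case True
    then show ?thesis
      using psd_row_zero[OF R m] that by (cases "R m m = 0") (auto simp: R'_def vv)
  next
    case False
    then have k: "k < m" using that by simp
    then have "R k m = 0" "R k j = 0" using R0 m that by auto
    then show ?thesis using symmetric_onD[OF R(1), of m k] k m by (simp add: R'_def vv)
  qed
  show ?case
  proof (intro exI conjI)
    show "\<forall>i<N. \<forall>j<N. Z i j = (\<Sum>k<Suc m. (u(m := v)) k i * (u(m := v)) k j) + R' i j"
    proof (intro allI impI)
      fix i j assume "i < N" "j < N"
      have "(\<Sum>k<m. (u(m := v)) k i * (u(m := v)) k j) = (\<Sum>k<m. u k i * u k j)"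
        by (intro sum.cong) auto
      then show "Z i j = (\<Sum>k<Suc m. (u(m := v)) k i * (u(m := v)) k j) + R' i j"
        using Z[OF \<open>i < N\<close> \<open>j < N\<close>] by (simp add: R'_def)
    qed
    show "symmetric_on N R'" using R(1) by (simp add: R'_def symmetric_on_def mult.commute)
  qed (use psd' zero in auto)
qed

lemma psd_gram:
  assumes "symmetric_on N Z" and "\<And>x. 0 \<le> quad_form N Z x"
  obtains u where "\<And>i j. i < N \<Longrightarrow> j < N \<Longrightarrow> Z i j = (\<Sum>k<N. u k i * u k j :: real)"
  using psd_gram_partial[OF assms order_refl] by auto

text \<open>Both sides of \<open>gap\<close> are linear in the rank-one matrix with entries x i * x
  j. Applying it to each coordinate of a Gram representation and summing lifts it to all of
  \<open>Z\<close>; \<open>Z i i + Z j j - 2 * Z i j\<close> is then the squared distance of two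
  Gram vectors.\<close>

lemma psd_distance_trace_bound:
  fixes w Z :: "nat \<Rightarrow> nat \<Rightarrow> real"
  assumes sym: "symmetric_on N Z" and psd: "\<And>x. 0 \<le> quad_form N Z x"
    and C: "C \<subseteq> {..<N}"
    and gap: "\<And>x. \<mu> * ((\<Sum>i\<in>C. (x i)\<^sup>2) - (\<Sum>i\<in>C. x i)\<^sup>2 / n)
        \<le> (\<Sum>i\<in>C. \<Sum>j\<in>C. w i j * (x i - x j)\<^sup>2) / 2"
  shows "\<mu> * ((\<Sum>i\<in>C. Z i i) - (\<Sum>i\<in>C. \<Sum>j\<in>C. Z i j) / n)
     \<le> (\<Sum>i\<in>C. \<Sum>j\<in>C. w i j * (Z i i + Z j j - 2 * Z i j)) / 2"
proof -
  obtain u where u: "\<And>i j. i < N \<Longrightarrow> j < N \<Longrightarrow> Z i j = (\<Sum>k<N. u k i * u k j)"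
    using psd_gram[OF sym psd] by blast
  have Z: "Z i j = (\<Sum>k<N. u k i * u k j)" if "i \<in> C" "j \<in> C" for i j
    using that C u by auto
  have a: "(\<Sum>i\<in>C. Z i i) = (\<Sum>k<N. \<Sum>i\<in>C. (u k i)\<^sup>2)"
    by (subst sum.swap) (simp add: Z power2_eq_square)
  have b: "(\<Sum>i\<in>C. \<Sum>j\<in>C. Z i j) = (\<Sum>k<N. (\<Sum>i\<in>C. u k i)\<^sup>2)"
  proof -
    have "(\<Sum>i\<in>C. \<Sum>j\<in>C. Z i j) = (\<Sum>i\<in>C. \<Sum>j\<in>C. \<Sum>k<N. u k i * u k j)"
      by (intro sum.cong refl) (simp add: Z)
    also have "\<dots> = (\<Sum>i\<in>C. \<Sum>k<N. \<Sum>j\<in>C. u k i * u k j)"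
      by (rule sum.cong[OF refl], rule sum.swap)
    also have "\<dots> = (\<Sum>k<N. (\<Sum>i\<in>C. u k i)\<^sup>2)"
      by (subst sum.swap) (simp add: power2_eq_square sum_product)
    finally show ?thesis .
  qed
  have c: "(\<Sum>i\<in>C. \<Sum>j\<in>C. w i j * (Z i i + Z j j - 2 * Z i j))
      = (\<Sum>k<N. \<Sum>i\<in>C. \<Sum>j\<in>C. w i j * (u k i - u k j)\<^sup>2)"
  proof -
    have "(\<Sum>i\<in>C. \<Sum>j\<in>C. w i j * (Z i i + Z j j - 2 * Z i j))
      = (\<Sum>i\<in>C. \<Sum>j\<in>C. \<Sum>k<N. w i j * (u k i - u k j)\<^sup>2)"
    proof (intro sum.cong refl)
      fix i j assume "i \<in> C" "j \<in> C"
      then have "Z i i + Z j j - 2 * Z i j = (\<Sum>k<N. (u k i - u k j)\<^sup>2)"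
        unfolding Z[OF \<open>i \<in> C\<close> \<open>i \<in> C\<close>] Z[OF \<open>j \<in> C\<close> \<open>j \<in> C\<close>] Z[OF \<open>i \<in> C\<close> \<open>j \<in> C\<close>]
          sum_distrib_left sum.distrib[symmetric] sum_subtractf[symmetric]
        by (intro sum.cong refl) (simp add: power2_eq_square algebra_simps)
      then show "w i j * (Z i i + Z j j - 2 * Z i j) = (\<Sum>k<N. w i j * (u k i - u k j)\<^sup>2)"
        by (simp add: sum_distrib_left)
    qed
    also have "\<dots> = (\<Sum>i\<in>C. \<Sum>k<N. \<Sum>j\<in>C. w i j * (u k i - u k j)\<^sup>2)"
      by (rule sum.cong[OF refl], rule sum.swap)
    also have "\<dots> = (\<Sum>k<N. \<Sum>i\<in>C. \<Sum>j\<in>C. w i j * (u k i - u k j)\<^sup>2)"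
      by (rule sum.swap)
    finally show ?thesis .
  qed
  have "\<mu> * ((\<Sum>i\<in>C. Z i i) - (\<Sum>i\<in>C. \<Sum>j\<in>C. Z i j) / n)
     = (\<Sum>k<N. \<mu> * ((\<Sum>i\<in>C. (u k i)\<^sup>2) - (\<Sum>i\<in>C. u k i)\<^sup>2 / n))"
    unfolding a b by (simp add: sum_distrib_left sum_subtractf sum_divide_distrib right_diff_distrib)
  also have "\<dots> \<le> (\<Sum>k<N. (\<Sum>i\<in>C. \<Sum>j\<in>C. w i j * (u k i - u k j)\<^sup>2) / 2)"
    by (intro sum_mono gap)
  also have "\<dots> = (\<Sum>i\<in>C. \<Sum>j\<in>C. w i j * (Z i i + Z j j - 2 * Z i j)) / 2"
    unfolding c by (simp add: sum_divide_distrib)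
  finally show ?thesis .
qed

section \<open>Optimality of the cluster matrix\<close>

text \<open>The test vector is e_i minus the mean of the indicator of \<open>C\<close>. Rows over
  \<open>C\<close> sum to 1, so the mean part contributes 1/n and the mixed part -2/n, leaving z i i
  - 1/n.\<close>

lemma psd_diag_lower_bound:
  fixes z :: "nat \<Rightarrow> nat \<Rightarrow> real"
  assumes sym: "symmetric_on N z" and psd: "\<And>x. 0 \<le> quad_form N z x"
    and C: "C \<subseteq> {..<N}" "card C = n" "n > 0"
    and row: "\<And>i. i \<in> C \<Longrightarrow> (\<Sum>j\<in>C. z i j) = 1" and i: "i \<in> C"
  shows "1 / n \<le> z i i"
proof -
  define x where "x = (\<lambda>k. if k \<in> C then - 1 / real n else 0)"
  have sumx: "(\<Sum>k<N. f k * x k) = - (\<Sum>k\<in>C. f k) / n" for f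
  proof -
    have "(\<Sum>k<N. f k * x k) = (\<Sum>k<N. if k \<in> C then f k * (- 1 / n) else 0)"
      by (intro sum.cong) (auto simp: x_def)
    also have "\<dots> = (\<Sum>k\<in>C. f k * (- 1 / n))"
      using C by (subst sum.inter_restrict[symmetric]) (auto simp: Int_absorb1)
    finally show ?thesis by (simp add: sum_divide_distrib sum_negf)
  qed
  have "quad_form N z x = (\<Sum>k<N. (\<Sum>l<N. z k l * x l) * x k)"
    unfolding quad_form_def sum_distrib_right by (intro sum.cong refl) (simp add: mult_ac)
  also have "\<dots> = (\<Sum>k\<in>C. (\<Sum>l\<in>C. z k l) / n) / n"
    by (simp add: sumx sum_negf sum_divide_distrib)
  also have "\<dots> = 1 / n"
    using C row by simp
  finally have q: "quad_form N z x = 1 / n" .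
  have "0 \<le> quad_form N z (\<lambda>k. x k + (if k = i then 1 else 0))" by (rule psd)
  also have "\<dots> = z i i - 1 / n"
    using i C row[OF i] quad_form_perturb[where m=i and x=x and t=1, OF _ sym] by (auto simp: q sumx)
  finally show ?thesis by simp
qed

lemma psd_entry_le:
  assumes sym: "symmetric_on N z" and psd: "\<And>x. 0 \<le> quad_form N z x"
    and "i < N" "j < N"
  shows "2 * z i j \<le> z i i + z j j"
proof -
  have "0 \<le> quad_form N z (\<lambda>k. (if k = i then 1 else 0) + (if k = j then - 1 else 0))"
    by (rule psd)
  also have "\<dots> = z i i - 2 * z j i + z j j"
    using assms quad_form_perturb[where m=j and x="\<lambda>k. if k = i then 1 else 0" and t="-1", OF _ sym] quad_form_unit[of i N z]
    by (simp add: if_distrib[of "\<lambda>u. _ * u"] sum.delta cong: if_cong)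
  finally show ?thesis using symmetric_onD[OF sym, of i j] assms by simp
qed

lemma sum_split_halves:
  fixes n :: nat
  assumes "A \<union> B = {..<2 * n}" "A \<inter> B = {}"
  shows "(\<Sum>k<2 * n. f k) = (\<Sum>k\<in>A. f k) + (\<Sum>k\<in>B. f k :: real)"
proof -
  have "finite A" "finite B" using assms(1) by (metis finite_Un finite_lessThan)+
  then show ?thesis using assms sum.union_disjoint[of A B f] by simp
qed

text \<open>Feasible points are treated as functions on pairs of indices. The weights are absent:
  they enter only through \<open>energy_lower_bound\<close>.\<close>

locale rcut_relaxation =
  fixes n :: nat and A B :: "nat set" and z :: "nat \<Rightarrow> nat \<Rightarrow> real"
  assumes n: "n > 0" and AB: "A \<union> B = {..<2 * n}" "A \<inter> B = {}" "card A = n" "card B = n"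
    and sym: "symmetric_on (2 * n) z"
    and psd: "\<And>x. 0 \<le> quad_form (2 * n) z x"
    and nonneg: "\<And>i j. i < 2 * n \<Longrightarrow> j < 2 * n \<Longrightarrow> 0 \<le> z i j"
    and trace: "(\<Sum>i<2 * n. z i i) = 2"
    and row: "\<And>i. i < 2 * n \<Longrightarrow> (\<Sum>j<2 * n. z i j) = 1"
begin

lemma mem: "i \<in> A \<Longrightarrow> i < 2 * n" "i \<in> B \<Longrightarrow> i < 2 * n"
  using AB by auto

lemma row_split: "i < 2 * n \<Longrightarrow> (\<Sum>j\<in>A. z i j) + (\<Sum>j\<in>B. z i j) = 1"
  using row sum_split_halves[OF AB(1,2)] by metis

text \<open>The mass between the communities, and the one parameter by which feasible points are
  compared: row sums fix the inner masses in terms of it, and it vanishes only at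
  \<open>X_rcut\<close>.\<close>

definition "spill = (\<Sum>i\<in>A. \<Sum>j\<in>B. z i j)"

lemma spill_nonneg: "0 \<le> spill"
  unfolding spill_def by (intro sum_nonneg nonneg) (auto dest: mem)

lemma spill_swap: "(\<Sum>j\<in>B. \<Sum>i\<in>A. z j i) = spill"
  unfolding spill_def by (subst sum.swap) (auto intro!: sum.cong symmetric_onD[OF sym] dest: mem)

lemma inner_mass: "(\<Sum>i\<in>A. \<Sum>j\<in>A. z i j) = n - spill" "(\<Sum>i\<in>B. \<Sum>j\<in>B. z i j) = n - spill"
proof -
  have "(\<Sum>i\<in>A. \<Sum>j\<in>A. z i j) + spill = (\<Sum>i\<in>A. 1)"
    unfolding spill_def sum.distrib[symmetric] using row_split by (intro sum.cong refl) (auto dest: mem)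
  then show "(\<Sum>i\<in>A. \<Sum>j\<in>A. z i j) = n - spill" using AB by simp
  have "(\<Sum>i\<in>B. \<Sum>j\<in>B. z i j) + (\<Sum>j\<in>B. \<Sum>i\<in>A. z j i) = (\<Sum>i\<in>B. 1)"
    unfolding sum.distrib[symmetric] using row_split mem(2) by (intro sum.cong refl) (simp add: add.commute)
  then show "(\<Sum>i\<in>B. \<Sum>j\<in>B. z i j) = n - spill" using AB spill_swap by simp
qed

text \<open>
  Test positive semidefiniteness on \<open>e\<^sub>i - e\<^sub>j\<close> with its component in the span of the
  two cluster indicators removed.
\<close>

lemma cross_distance:
  assumes i: "i \<in> A" and j: "j \<in> B"
  shows "2 / n - 4 / n * ((\<Sum>k\<in>B. z i k) + (\<Sum>k\<in>A. z j k)) \<le> z i i + z j j - 2 * z i j"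
proof -
  \<comment> \<open>Minus the projection of e_i - e_j onto the two indicators. It depends on neither
    \<open>i\<close> nor \<open>j\<close>; its own value \<open>q\<close> follows from the block
    masses.\<close>
  define x where "x = (\<lambda>k. if k \<in> A then - 1 / real n else 1 / real n)"
  have sumx: "(\<Sum>k<2 * n. f k * x k) = ((\<Sum>k\<in>B. f k) - (\<Sum>k\<in>A. f k)) / n" for f
  proof -
    have "(\<Sum>k\<in>A. f k * x k) = (\<Sum>k\<in>A. - f k / n)" "(\<Sum>k\<in>B. f k * x k) = (\<Sum>k\<in>B. f k / n)"
      using AB by (auto simp: x_def intro!: sum.cong)
    then show ?thesis
      unfolding sum_split_halves[OF AB(1,2)] by (simp add: sum_divide_distrib sum_negf diff_divide_distrib)
  qed
  have "quad_form (2 * n) z x = (\<Sum>k<2 * n. (\<Sum>l<2 * n. z k l * x l) * x k)"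
    unfolding quad_form_def sum_distrib_right by (intro sum.cong refl) (simp add: mult_ac)
  also have "\<dots> = ((\<Sum>k\<in>B. \<Sum>l\<in>B. z k l) - (\<Sum>k\<in>B. \<Sum>l\<in>A. z k l) - (\<Sum>k\<in>A. \<Sum>l\<in>B. z k l)
       + (\<Sum>k\<in>A. \<Sum>l\<in>A. z k l)) / n / n"
    unfolding sumx by (simp add: sum_subtractf sum_divide_distrib[symmetric] diff_divide_distrib add_divide_distrib)
  also have "\<dots> = 2 * (n - 2 * spill) / n / n"
    unfolding inner_mass spill_swap by (simp add: spill_def)
  also have "\<dots> \<le> 2 / n"
    using n spill_nonneg by (simp add: field_simps)
  finally have q: "quad_form (2 * n) z x \<le> 2 / n" .
  define c d where "c = (\<Sum>k\<in>B. z i k)" and "d = (\<Sum>k\<in>A. z j k)"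
  have ri: "(\<Sum>k\<in>A. z i k) = 1 - c" and rj: "(\<Sum>k\<in>B. z j k) = 1 - d"
    using row_split[of i] row_split[of j] mem i j by (auto simp: c_def d_def)
  define y where "y = (\<lambda>k. x k + (if k = i then 1 else 0))"
  have qy: "quad_form (2 * n) z y = quad_form (2 * n) z x + 2 * ((2 * c - 1) / n) + z i i"
    using quad_form_perturb[where x=x and t=1, OF mem(1)[OF i] sym] unfolding y_def sumx c_def[symmetric] ri by simp
  have "(\<Sum>k<2*n. z j k * y k) = (\<Sum>k<2*n. z j k * x k) + z j i"
    using mem(1)[OF i] unfolding y_def
    by (simp add: algebra_simps sum.distrib if_distrib[of "\<lambda>u. _ * u"] sum.delta cong: if_cong)
  then have sy: "(\<Sum>k<2*n. z j k * y k) = (1 - 2 * d) / n + z j i"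
    unfolding sumx rj d_def[symmetric] by simp
  have "0 \<le> quad_form (2 * n) z (\<lambda>k. y k + (if k = j then -1 else 0))" by (rule psd)
  also have "\<dots> = quad_form (2 * n) z x + 2 * ((2 * c - 1) / n) + z i i - 2 * ((1 - 2 * d) / n + z j i) + z j j"
    using quad_form_perturb[where x=y and t="-1", OF mem(2)[OF j] sym] unfolding qy sy by simp
  also have "\<dots> \<le> 2 / n + 2 * ((2 * c - 1) / n) + z i i - 2 * ((1 - 2 * d) / n + z j i) + z j j"
    using q by simp
  also have "\<dots> = - (2 / n - 4 / n * (c + d)) + (z i i + z j j - 2 * z i j)"
    using symmetric_onD[OF sym mem(1)[OF i] mem(2)[OF j]]
    by (simp add: diff_divide_distrib add_divide_distrib algebra_simps)
  finally show ?thesis unfolding c_def d_def by simp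
qed

text \<open>The first term on the left is the objective at \<open>X_rcut\<close>, so the second is
  the excess. The two inner traces add up to 2 while each inner mass is n - spill, so the gap terms
  leave \<mu> * (2 - 2 (n - spill) / n). In the cross term each row's spilled mass is weighted by
  that vertex's outer degree; bounding this by \<open>T\<close> at both endpoints costs twice 4 T
  spill / n.\<close>

lemma energy_lower_bound:
  fixes w :: "nat \<Rightarrow> nat \<Rightarrow> real"
  assumes wsym: "\<And>i j. i < 2 * n \<Longrightarrow> j < 2 * n \<Longrightarrow> w i j = w j i"
    and wnonneg: "\<And>i j. i < 2 * n \<Longrightarrow> j < 2 * n \<Longrightarrow> 0 \<le> w i j"
    and gap: "\<And>C x. C = A \<or> C = B \<Longrightarrow> \<mu> * ((\<Sum>i\<in>C. (x i)\<^sup>2) - (\<Sum>i\<in>C. x i)\<^sup>2 / n)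
        \<le> (\<Sum>i\<in>C. \<Sum>j\<in>C. w i j * (x i - x j)\<^sup>2) / 2"
    and out: "\<And>i. i \<in> A \<Longrightarrow> (\<Sum>j\<in>B. w i j) \<le> T" "\<And>j. j \<in> B \<Longrightarrow> (\<Sum>i\<in>A. w j i) \<le> T"
  shows "2 / n * (\<Sum>i\<in>A. \<Sum>j\<in>B. w i j) + (2 * \<mu> - 8 * T) / n * spill
      \<le> (\<Sum>i<2 * n. \<Sum>j<2 * n. w i j * (z i i + z j j - 2 * z i j)) / 2"
proof -
  define e where "e = (\<lambda>i j. w i j * (z i i + z j j - 2 * z i j))"
  define c where "c = (\<lambda>i. \<Sum>k\<in>B. z i k)"
  define d where "d = (\<lambda>j. \<Sum>k\<in>A. z j k)"
  have in_block: "\<mu> * ((\<Sum>i\<in>C. z i i) - (n - spill) / n) \<le> (\<Sum>i\<in>C. \<Sum>j\<in>C. e i j) / 2"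
    if "C = A \<or> C = B" for C
  proof -
    have "C \<subseteq> {..<2 * n}" using that mem by auto
    from psd_distance_trace_bound[OF sym psd this gap[OF that]] show ?thesis
      using that inner_mass by (auto simp: e_def)
  qed
  have eBA: "(\<Sum>i\<in>B. \<Sum>j\<in>A. e i j) = (\<Sum>i\<in>A. \<Sum>j\<in>B. e i j)"
  proof -
    have "(\<Sum>i\<in>B. \<Sum>j\<in>A. e i j) = (\<Sum>i\<in>A. \<Sum>j\<in>B. e j i)" by (rule sum.swap)
    also have "\<dots> = (\<Sum>i\<in>A. \<Sum>j\<in>B. e i j)"
    proof (intro sum.cong refl)
      fix i j assume "i \<in> A" "j \<in> B"
      then have "i < 2 * n" "j < 2 * n" using mem by auto
      then show "e j i = e i j" using symmetric_onD[OF sym, of i j] wsym[of i j] by (simp add: e_def)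
    qed
    finally show ?thesis .
  qed
  have cross: "2 / n * (\<Sum>i\<in>A. \<Sum>j\<in>B. w i j) - 8 * T / n * spill \<le> (\<Sum>i\<in>A. \<Sum>j\<in>B. e i j)"
  proof -
    have "(\<Sum>i\<in>A. \<Sum>j\<in>B. w i j * c i) = (\<Sum>i\<in>A. (\<Sum>j\<in>B. w i j) * c i)"
      by (simp add: sum_distrib_right)
    also have "\<dots> \<le> (\<Sum>i\<in>A. T * c i)"
      using out by (intro sum_mono mult_right_mono) (auto simp: c_def intro!: sum_nonneg nonneg dest: mem)
    also have "\<dots> = T * spill" by (simp add: sum_distrib_left spill_def c_def)
    finally have wc: "(\<Sum>i\<in>A. \<Sum>j\<in>B. w i j * c i) \<le> T * spill" .
    have "(\<Sum>i\<in>A. \<Sum>j\<in>B. w i j * d j) = (\<Sum>j\<in>B. \<Sum>i\<in>A. w i j * d j)" by (rule sum.swap)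
    also have "\<dots> = (\<Sum>j\<in>B. \<Sum>i\<in>A. w j i * d j)"
    proof (intro sum.cong refl)
      fix i j assume "i \<in> A" "j \<in> B"
      then show "w i j * d j = w j i * d j" using wsym[of i j] mem by simp
    qed
    also have "\<dots> = (\<Sum>j\<in>B. (\<Sum>i\<in>A. w j i) * d j)"
      by (simp add: sum_distrib_right)
    also have "\<dots> \<le> (\<Sum>j\<in>B. T * d j)"
      using out by (intro sum_mono mult_right_mono) (auto simp: d_def intro!: sum_nonneg nonneg dest: mem)
    also have "\<dots> = T * spill" by (simp add: sum_distrib_left spill_swap[symmetric] d_def)
    finally have wd: "(\<Sum>i\<in>A. \<Sum>j\<in>B. w i j * d j) \<le> T * spill" .
    have "2 / n * (\<Sum>i\<in>A. \<Sum>j\<in>B. w i j) - 8 * T / n * spill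
       \<le> 2 / n * (\<Sum>i\<in>A. \<Sum>j\<in>B. w i j)
         - 4 / n * ((\<Sum>i\<in>A. \<Sum>j\<in>B. w i j * c i) + (\<Sum>i\<in>A. \<Sum>j\<in>B. w i j * d j))"
    proof -
      have "4 / n * ((\<Sum>i\<in>A. \<Sum>j\<in>B. w i j * c i) + (\<Sum>i\<in>A. \<Sum>j\<in>B. w i j * d j)) \<le> 4 / n * (2 * (T * spill))"
        using wc wd by (intro mult_left_mono) auto
      then show ?thesis by simp
    qed
    also have "\<dots> = (\<Sum>i\<in>A. \<Sum>j\<in>B. w i j * (2 / n - 4 / n * (c i + d j)))"
      unfolding sum.distrib[symmetric] sum_distrib_left sum_subtractf[symmetric]
      by (intro sum.cong refl) (simp add: algebra_simps add_divide_distrib)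
    also have "\<dots> \<le> (\<Sum>i\<in>A. \<Sum>j\<in>B. e i j)"
      unfolding e_def c_def d_def
      by (intro sum_mono mult_left_mono cross_distance wnonneg) (auto dest: mem)
    finally show ?thesis .
  qed
  have tr: "(\<Sum>i\<in>A. z i i) + (\<Sum>i\<in>B. z i i) = 2"
    using trace sum_split_halves[OF AB(1,2)] by metis
  have "2 / n * (\<Sum>i\<in>A. \<Sum>j\<in>B. w i j) + (2 * \<mu> - 8 * T) / n * spill
     = (2 / n * (\<Sum>i\<in>A. \<Sum>j\<in>B. w i j) - 8 * T / n * spill) + \<mu> * (2 - 2 * ((n - spill) / n))"
    using n by (simp add: field_simps)
  also have "\<mu> * (2 - 2 * ((n - spill) / n))
     = \<mu> * ((\<Sum>i\<in>A. z i i) - (n - spill) / n) + \<mu> * ((\<Sum>i\<in>B. z i i) - (n - spill) / n)"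
    unfolding distrib_left[symmetric] using tr by (simp add: diff_divide_distrib)
  also have "(2 / n * (\<Sum>i\<in>A. \<Sum>j\<in>B. w i j) - 8 * T / n * spill) + \<dots>
     \<le> (\<Sum>i\<in>A. \<Sum>j\<in>B. e i j) + (\<Sum>i\<in>A. \<Sum>j\<in>A. e i j) / 2 + (\<Sum>i\<in>B. \<Sum>j\<in>B. e i j) / 2"
    using cross in_block[OF disjI1[OF refl]] in_block[OF disjI2[OF refl]] by linarith
  also have "\<dots> = (\<Sum>i<2 * n. \<Sum>j<2 * n. e i j) / 2"
    unfolding sum_split_halves[OF AB(1,2)] sum.distrib eBA by simp
  finally show ?thesis by (simp add: e_def)
qed

text \<open>Two squeezes. The diagonal entries are at least 1/n and have total 2, so all equal 1/n.
  Then the entries within a block are at most 1/n by 2 x 2 positivity, while \<open>n\<close> of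
  them sum to 1, so these are equal to 1/n too.\<close>

lemma spill_zero_imp:
  assumes s: "spill = 0" and i: "i < 2 * n" and j: "j < 2 * n"
  shows "z i j = (if (i \<in> A) = (j \<in> A) then 1 / n else 0)"
proof -
  have fin: "finite A" "finite B" using AB(1) by (metis finite_Un finite_lessThan)+
  have zAB: "z i j = 0" if "i \<in> A" "j \<in> B" for i j
  proof -
    have nn: "\<And>i j. i \<in> A \<Longrightarrow> j \<in> B \<Longrightarrow> 0 \<le> z i j" using nonneg mem by auto
    have "(\<Sum>j\<in>B. z i j) = 0"
      using s that fin nn unfolding spill_def by (subst (asm) sum_nonneg_eq_0_iff) (auto intro!: sum_nonneg)
    then show ?thesis using that fin nn by (subst (asm) sum_nonneg_eq_0_iff) auto
  qed
  then have zBA: "z i j = 0" if "i \<in> B" "j \<in> A" for i j using that symmetric_onD[OF sym, of i j] mem by simp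
  have rows: "(\<Sum>k\<in>C. z i k) = 1" if "i \<in> C" "C = A \<or> C = B" for i C
    using that row_split[of i] mem zAB zBA by auto
  have ge: "1 / n \<le> z i i" if "i < 2 * n" for i
  proof -
    obtain C where C: "C = A \<or> C = B" "i \<in> C" using \<open>i < 2 * n\<close> AB(1) by blast
    have "C \<subseteq> {..<2 * n}" "card C = n" using C mem AB by auto
    then show ?thesis using psd_diag_lower_bound[OF sym psd _ _ n rows[OF _ C(1)] C(2)] by auto
  qed
  have diag: "z i i = 1 / n" if "i < 2 * n" for i
  proof -
    have "(\<Sum>i<2 * n. z i i - 1 / n) = 0" using trace n by (simp add: sum_subtractf)
    then show ?thesis using ge that by (subst (asm) sum_nonneg_eq_0_iff) auto
  qed
  have same: "z i j = 1 / n" if C: "C = A \<or> C = B" "i \<in> C" "j \<in> C" for C i j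
  proof -
    have m: "\<And>k. k \<in> C \<Longrightarrow> k < 2 * n" using C mem by auto
    have le: "z i k \<le> 1 / n" if "k \<in> C" for k
      using psd_entry_le[OF sym psd, of i k] diag m that C by simp
    have "card C = n" "finite C" using C AB fin by auto
    then have "(\<Sum>k\<in>C. 1 / n - z i k) = 0" using rows[OF C(2,1)] n by (simp add: sum_subtractf)
    then have "\<forall>k\<in>C. 1 / n - z i k = 0"
      using le \<open>finite C\<close> by (subst (asm) sum_nonneg_eq_0_iff) auto
    from bspec[OF this C(3)] show ?thesis by simp
  qed
  have "i \<in> A \<or> i \<in> B" "j \<in> A \<or> j \<in> B" using i j AB(1) by auto
  then show ?thesis
    using AB(2) zAB zBA same[of A] same[of B] by (cases "i \<in> A"; cases "j \<in> A") auto
qed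

end

section \<open>From the matrix program to entrywise sums, and the deterministic recovery
  criterion\<close>

lemma frobenius_laplacian:
  assumes W: "W \<in> carrier_mat N N" "transpose_mat W = W" and Z: "Z \<in> carrier_mat N N"
  shows "frobenius_inner (laplacian N W) Z =
    (\<Sum>i<N. \<Sum>j<N. W $$ (i, j) * (Z $$ (i, i) + Z $$ (j, j) - 2 * Z $$ (i, j))) / 2"
proof -
  have Wsym: "W $$ (i, j) = W $$ (j, i)" if "i < N" "j < N" for i j
    using W that by (metis carrier_matD index_transpose_mat(1))
  have L: "laplacian N W $$ (i, j) = (if i = j then (\<Sum>k<N. W $$ (i, k)) else 0) - W $$ (i, j)"
    if "i < N" "j < N" for i j
    using W that by (auto simp: laplacian_def mat_diag_def ones_vec_def scalar_prod_def atLeast0LessThan)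
  have "frobenius_inner (laplacian N W) Z =
      (\<Sum>i<N. \<Sum>j<N. ((if i = j then (\<Sum>k<N. W $$ (i, k)) * Z $$ (i, j) else 0) - W $$ (i, j) * Z $$ (i, j)))"
  proof -
    have "dim_row (laplacian N W) = N" "dim_col (laplacian N W) = N"
      using W by (auto simp: laplacian_def mat_diag_def)
    then show ?thesis
      unfolding frobenius_inner_def by (intro sum.cong) (auto simp: L left_diff_distrib)
  qed
  also have "\<dots> = (\<Sum>i<N. \<Sum>k<N. W $$ (i, k) * Z $$ (i, i)) - (\<Sum>i<N. \<Sum>j<N. W $$ (i, j) * Z $$ (i, j))"
    by (simp add: sum_subtractf sum.delta sum_distrib_right)
  finally have a: "frobenius_inner (laplacian N W) Z = \<dots>" .
  have "(\<Sum>i<N. \<Sum>k<N. W $$ (i, k) * Z $$ (i, i)) = (\<Sum>i<N. \<Sum>k<N. W $$ (i, k) * Z $$ (k, k))"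
    by (subst sum.swap) (intro sum.cong, auto simp: Wsym)
  then show ?thesis unfolding a
    by (simp add: distrib_left right_diff_distrib sum.distrib sum_subtractf sum_distrib_left[symmetric]
        mult.left_commute[of _ 2])
qed

lemma quad_form_scalar_prod:
  assumes "Z \<in> carrier_mat N N"
  shows "vec N x \<bullet> (Z *\<^sub>v vec N x) = quad_form N (\<lambda>i j. Z $$ (i, j)) x"
  using assms by (simp add: scalar_prod_def quad_form_def sum_distrib_left atLeast0LessThan
      mult.left_commute mult.commute)

lemma X_rcut_two:
  assumes "two_communities n \<Gamma>" "i < 2 * n" "j < 2 * n"
  shows "X_rcut (2 * n) 2 \<Gamma> $$ (i, j) = (if (i \<in> \<Gamma> 1) = (j \<in> \<Gamma> 1) then 1 / n else 0)"
proof -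
  have "{1..2} = {1, 2::nat}" by auto
  then show ?thesis
    using assms by (auto simp: X_rcut_def two_communities_def indicator_def)
qed

lemma rcut_relaxation_of_feasible:
  assumes "rcut_feasible (2 * n) 2 Z" "two_communities n \<Gamma>" "n > 0"
  shows "rcut_relaxation n (\<Gamma> 1) (\<Gamma> 2) (\<lambda>i j. Z $$ (i, j))"
proof
  have Z: "Z \<in> carrier_mat (2 * n) (2 * n)" "transpose_mat Z = Z"
    using assms by (auto simp: rcut_feasible_def)
  show "0 \<le> quad_form (2 * n) (\<lambda>i j. Z $$ (i, j)) x" for x
    unfolding quad_form_scalar_prod[OF Z(1), symmetric]
    using assms by (auto simp: rcut_feasible_def pos_semidef_def)
  show "symmetric_on (2 * n) (\<lambda>i j. Z $$ (i, j))"
    unfolding symmetric_on_def using Z by (metis carrier_matD index_transpose_mat(1))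
  show "(\<Sum>i<2 * n. Z $$ (i, i)) = 2"
    using assms Z by (auto simp: rcut_feasible_def mat_trace_def)
  show "(\<Sum>j<2 * n. Z $$ (i, j)) = 1" if "i < 2 * n" for i
  proof -
    have "(Z *\<^sub>v ones_vec (2 * n)) $ i = ones_vec (2 * n) $ i"
      using assms by (simp add: rcut_feasible_def)
    then show ?thesis
      using Z that by (auto simp: ones_vec_def scalar_prod_def atLeast0LessThan)
  qed
qed (use assms in \<open>auto simp: rcut_feasible_def two_communities_def\<close>)

lemma X_rcut_feasible:
  assumes tc: "two_communities n \<Gamma>" and n: "n > 0"
  shows "rcut_feasible (2 * n) 2 (X_rcut (2 * n) 2 \<Gamma>)"
proof -
  let ?X = "X_rcut (2 * n) 2 \<Gamma>" and ?A = "\<Gamma> 1" and ?B = "\<Gamma> 2"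
  have AB: "?A \<union> ?B = {..<2 * n}" "?A \<inter> ?B = {}" "card ?A = n" "card ?B = n"
    using tc by (auto simp: two_communities_def)
  note split = sum_split_halves[OF AB(1,2)]
  have carr: "?X \<in> carrier_mat (2 * n) (2 * n)" by (simp add: X_rcut_def)
  note X = X_rcut_two[OF tc]
  have symm: "transpose_mat ?X = ?X"
    using carr by (intro eq_matI) (auto simp: X)
  \<comment> \<open>Kept general in \<open>x\<close>: a vector \<open>v\<close> gives positive
    semidefiniteness as a sum of two squares, the constant 1 gives the row sums.\<close>
  have rowsum: "(\<Sum>j<2 * n. ?X $$ (i, j) * x j) = (if i \<in> ?A then (\<Sum>j\<in>?A. x j) else (\<Sum>j\<in>?B. x j)) / n"
    if "i < 2 * n" for i x
  proof -
    have mem: "j < 2 * n" "j \<in> ?B \<Longrightarrow> j \<notin> ?A" if "j \<in> ?A \<or> j \<in> ?B" for j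
      using that AB(1,2) by auto
    have "?X $$ (i, j) = (if i \<in> ?A then 1 / n else 0)" if "j \<in> ?A" for j
      using X[OF \<open>i < 2 * n\<close> mem(1)] that by simp
    then have A: "(\<Sum>j\<in>?A. ?X $$ (i, j) * x j) = (if i \<in> ?A then (\<Sum>j\<in>?A. x j) / n else 0)"
      by (simp add: sum_divide_distrib)
    have "?X $$ (i, j) = (if i \<in> ?A then 0 else 1 / n)" if "j \<in> ?B" for j
      using X[OF \<open>i < 2 * n\<close> mem(1)] mem(2) that by simp
    then have B: "(\<Sum>j\<in>?B. ?X $$ (i, j) * x j) = (if i \<in> ?A then 0 else (\<Sum>j\<in>?B. x j) / n)"
      by (simp add: sum_divide_distrib)
    show ?thesis unfolding split A B by simp
  qed
  have "0 \<le> v \<bullet> (?X *\<^sub>v v)" if v: "v \<in> carrier_vec (2 * n)" for v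
  proof -
    have "v \<bullet> (?X *\<^sub>v v) = (\<Sum>i<2 * n. (\<Sum>j<2 * n. ?X $$ (i, j) * v $ j) * v $ i)"
      using v carr by (simp add: scalar_prod_def atLeast0LessThan mult.commute)
    also have "\<dots> = (\<Sum>i<2 * n. (if i \<in> ?A then (\<Sum>j\<in>?A. v $ j) else (\<Sum>j\<in>?B. v $ j)) / n * v $ i)"
      by (intro sum.cong refl) (simp add: rowsum)
    also have "\<dots> = (\<Sum>i\<in>?A. (\<Sum>j\<in>?A. v $ j) / n * v $ i) + (\<Sum>i\<in>?B. (\<Sum>j\<in>?B. v $ j) / n * v $ i)"
      unfolding split using AB by (intro arg_cong2[of _ _ _ _ "(+)"] sum.cong refl) auto
    also have "\<dots> = (\<Sum>i\<in>?A. v $ i)\<^sup>2 / n + (\<Sum>i\<in>?B. v $ i)\<^sup>2 / n"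
      unfolding sum_distrib_left[symmetric] by (simp add: power2_eq_square)
    finally show ?thesis by simp
  qed
  moreover have "?X *\<^sub>v ones_vec (2 * n) = ones_vec (2 * n)"
  proof (intro eq_vecI)
    fix i assume "i < dim_vec (ones_vec (2 * n))"
    then have i: "i < 2 * n" by (simp add: ones_vec_def)
    then have "(?X *\<^sub>v ones_vec (2 * n)) $ i = (\<Sum>j<2 * n. ?X $$ (i, j) * 1)"
      using carr by (auto simp: ones_vec_def scalar_prod_def atLeast0LessThan)
    also have "\<dots> = 1" unfolding rowsum[OF i] using AB n by simp
    finally show "(?X *\<^sub>v ones_vec (2 * n)) $ i = ones_vec (2 * n) $ i" using i by (simp add: ones_vec_def)
  qed (use carr in \<open>simp add: ones_vec_def\<close>)
  moreover have "mat_trace ?X = 2"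
    using carr n by (simp add: mat_trace_def X)
  ultimately show ?thesis
    unfolding rcut_feasible_def pos_semidef_def using carr symm by (auto simp: X)
qed

text \<open>Since 4 T < \<mu>, the excess over the value at \<open>X_rcut\<close> is a positive
  multiple of \<open>spill\<close>. A minimizer therefore has no spill, which determines it; this
  gives optimality and uniqueness together.\<close>

theorem rcut_recovers_of_spectral_gap:
  assumes n: "n > 0" and tc: "two_communities n \<Gamma>"
    and W: "W \<in> carrier_mat (2 * n) (2 * n)" "transpose_mat W = W"
    and Wnonneg: "\<And>i j. i < 2 * n \<Longrightarrow> j < 2 * n \<Longrightarrow> 0 \<le> W $$ (i, j)"
    and gap: "\<And>C x. C = \<Gamma> 1 \<or> C = \<Gamma> 2 \<Longrightarrow> \<mu> * ((\<Sum>i\<in>C. (x i)\<^sup>2) - (\<Sum>i\<in>C. x i)\<^sup>2 / n)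
        \<le> (\<Sum>i\<in>C. \<Sum>j\<in>C. W $$ (i, j) * (x i - x j)\<^sup>2) / 2"
    and out: "\<And>i. i \<in> \<Gamma> 1 \<Longrightarrow> (\<Sum>j\<in>\<Gamma> 2. W $$ (i, j)) \<le> T"
      "\<And>j. j \<in> \<Gamma> 2 \<Longrightarrow> (\<Sum>i\<in>\<Gamma> 1. W $$ (j, i)) \<le> T"
    and T: "4 * T < \<mu>"
  shows "rcut_recovers (2 * n) 2 W \<Gamma>"
proof -
  let ?X = "X_rcut (2 * n) 2 \<Gamma>" and ?f = "frobenius_inner (laplacian (2 * n) W)"
  define opt where "opt = 2 / n * (\<Sum>i\<in>\<Gamma> 1. \<Sum>j\<in>\<Gamma> 2. W $$ (i, j))"
  have AB: "\<Gamma> 1 \<union> \<Gamma> 2 = {..<2 * n}" "\<Gamma> 1 \<inter> \<Gamma> 2 = {}"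
    using tc by (auto simp: two_communities_def)
  have Wsym: "W $$ (i, j) = W $$ (j, i)" if "i < 2 * n" "j < 2 * n" for i j
    using W that by (metis carrier_matD index_transpose_mat(1))
  have carr: "?X \<in> carrier_mat (2 * n) (2 * n)" by (simp add: X_rcut_def)
  have fX: "?f ?X = opt"
  proof -
    \<comment> \<open>Under \<open>X_rcut\<close> the squared distance is 0 within a community and
      1/n + 1/n across.\<close>
    define g where "g = (\<lambda>i j. if (i \<in> \<Gamma> 1) = (j \<in> \<Gamma> 1) then 0 else 2 / n * W $$ (i, j))"
    have "?f ?X = (\<Sum>i<2 * n. \<Sum>j<2 * n. g i j) / 2"
      unfolding frobenius_laplacian[OF W carr]
      by (intro arg_cong2[of _ _ _ _ "(/)"] sum.cong refl) (auto simp: X_rcut_two[OF tc] g_def)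
    also have "\<dots> = ((\<Sum>i\<in>\<Gamma> 1. \<Sum>j\<in>\<Gamma> 2. g i j) + (\<Sum>i\<in>\<Gamma> 2. \<Sum>j\<in>\<Gamma> 1. g i j)) / 2"
    proof -
      have "(\<Sum>i\<in>\<Gamma> 1. \<Sum>j\<in>\<Gamma> 1. g i j) = 0" "(\<Sum>i\<in>\<Gamma> 2. \<Sum>j\<in>\<Gamma> 2. g i j) = 0"
        using AB(2) by (auto simp: g_def intro!: sum.neutral)
      then show ?thesis unfolding sum_split_halves[OF AB] sum.distrib by simp
    qed
    also have "(\<Sum>i\<in>\<Gamma> 2. \<Sum>j\<in>\<Gamma> 1. g i j) = (\<Sum>i\<in>\<Gamma> 1. \<Sum>j\<in>\<Gamma> 2. g i j)"
    proof (subst sum.swap, intro sum.cong refl)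
      fix i j assume "i \<in> \<Gamma> 1" "j \<in> \<Gamma> 2"
      then have "i < 2 * n" "j < 2 * n" using AB by auto
      then show "g j i = g i j" using Wsym[of i j] by (simp add: g_def)
    qed
    also have "(\<Sum>i\<in>\<Gamma> 1. \<Sum>j\<in>\<Gamma> 2. g i j) = opt"
      unfolding opt_def sum_distrib_left using AB by (intro sum.cong refl) (auto simp: g_def)
    finally show ?thesis by simp
  qed
  have lower: "opt \<le> ?f Z \<and> (?f Z \<le> opt \<longrightarrow> Z = ?X)" if Z: "rcut_feasible (2 * n) 2 Z" for Z
  proof -
    interpret rcut_relaxation n "\<Gamma> 1" "\<Gamma> 2" "\<lambda>i j. Z $$ (i, j)"
      by (rule rcut_relaxation_of_feasible[OF Z tc n])
    have carrZ: "Z \<in> carrier_mat (2 * n) (2 * n)" using Z by (simp add: rcut_feasible_def)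
    have b: "opt + (2 * \<mu> - 8 * T) / n * spill \<le> ?f Z"
      unfolding opt_def frobenius_laplacian[OF W carrZ]
      by (rule energy_lower_bound) (rule Wsym Wnonneg gap out; assumption)+
    have pos: "(2 * \<mu> - 8 * T) / n > 0" using T n by simp
    have "opt \<le> ?f Z"
      using b spill_nonneg mult_nonneg_nonneg[OF less_imp_le[OF pos] spill_nonneg] by linarith
    moreover have "Z = ?X" if "?f Z \<le> opt"
    proof -
      have "(2 * \<mu> - 8 * T) / n * spill \<le> 0" using b that by linarith
      then have "spill \<le> 0" using mult_pos_pos[OF pos] by (metis not_le)
      then have s: "spill = 0" using spill_nonneg by simp
      show ?thesis
        using carrZ carr by (intro eq_matI) (simp_all add: X_rcut_two[OF tc] spill_zero_imp[OF s])
    qed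
    ultimately show ?thesis by blast
  qed
  show ?thesis
    unfolding rcut_recovers_def is_arg_min_def
  proof (intro allI iffI)
    fix Z
    assume min: "rcut_feasible (2 * n) 2 Z \<and> \<not> (\<exists>y. rcut_feasible (2 * n) 2 y \<and> ?f y < ?f Z)"
    have "\<not> ?f ?X < ?f Z"
    proof
      assume "?f ?X < ?f Z"
      with X_rcut_feasible[OF tc n] have "\<exists>y. rcut_feasible (2 * n) 2 y \<and> ?f y < ?f Z"
        by (intro exI conjI)
      with conjunct2[OF min] show False by (rule notE)
    qed
    then have "?f Z \<le> opt" unfolding fX by (rule leI)
    with lower[OF conjunct1[OF min]] show "Z = ?X" by (elim conjE mp)
  next
    fix Z
    assume Z: "Z = ?X"
    have not_less: "\<not> ?f y < ?f Z" if "rcut_feasible (2 * n) 2 y" for y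
      using lower[OF that] unfolding Z fX by simp
    show "rcut_feasible (2 * n) 2 Z \<and> \<not> (\<exists>y. rcut_feasible (2 * n) 2 y \<and> ?f y < ?f Z)"
    proof (intro conjI notI)
      show "rcut_feasible (2 * n) 2 Z" unfolding Z by (rule X_rcut_feasible[OF tc n])
      assume "\<exists>y. rcut_feasible (2 * n) 2 y \<and> ?f y < ?f Z"
      then obtain y where "rcut_feasible (2 * n) 2 y" "?f y < ?f Z" by (elim exE conjE)
      then show False using not_less[of y] by simp
    qed
  qed
qed

section \<open>Discrepancy and the spectral gap\<close>

text \<open>Coefficients in [-1, 1] give at most the sum of absolute values; one of the two sign
  classes of \<open>c\<close> carries at least half of it.\<close>

lemma sum_bounded_coeff_le_subset_sum:
  fixes c f :: "'a \<Rightarrow> real"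
  assumes fin: "finite S" and f: "\<And>i. i \<in> S \<Longrightarrow> \<bar>f i\<bar> \<le> 1"
  shows "\<exists>S'\<subseteq>S. \<bar>\<Sum>i\<in>S. f i * c i\<bar> \<le> 2 * \<bar>\<Sum>i\<in>S'. c i\<bar>"
proof -
  define P where "P = {i \<in> S. c i \<ge> 0}"
  have PS: "P \<subseteq> S" "S - P \<subseteq> S" by (auto simp: P_def)
  have "\<bar>\<Sum>i\<in>S. f i * c i\<bar> \<le> (\<Sum>i\<in>S. \<bar>c i\<bar>)"
    using f by (intro order_trans[OF sum_abs] sum_mono) (simp add: abs_mult mult_left_le_one_le)
  also have "\<dots> = (\<Sum>i\<in>S - P. \<bar>c i\<bar>) + (\<Sum>i\<in>P. \<bar>c i\<bar>)"
    using fin PS(1) by (rule sum.subset_diff[rotated])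
  also have "(\<Sum>i\<in>P. \<bar>c i\<bar>) = (\<Sum>i\<in>P. c i)"
    by (intro sum.cong) (auto simp: P_def)
  also have "(\<Sum>i\<in>S - P. \<bar>c i\<bar>) = - (\<Sum>i\<in>S - P. c i)"
    unfolding sum_negf[symmetric] by (intro sum.cong) (auto simp: P_def)
  finally have *: "\<bar>\<Sum>i\<in>S. f i * c i\<bar> \<le> - (\<Sum>i\<in>S - P. c i) + (\<Sum>i\<in>P. c i)" .
  show ?thesis
  proof (cases "\<bar>\<Sum>i\<in>S - P. c i\<bar> \<le> \<bar>\<Sum>i\<in>P. c i\<bar>")
    case True
    with * have "\<bar>\<Sum>i\<in>S. f i * c i\<bar> \<le> 2 * \<bar>\<Sum>i\<in>P. c i\<bar>" by linarith
    with PS show ?thesis by blast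
  next
    case False
    with * have "\<bar>\<Sum>i\<in>S. f i * c i\<bar> \<le> 2 * \<bar>\<Sum>i\<in>S - P. c i\<bar>" by linarith
    with PS show ?thesis by blast
  qed
qed

text \<open>Coefficients are replaced by indicators, first in \<open>i\<close> and then in
  \<open>j\<close>, at a factor 2 each. The subsets chosen depend on the coefficients, which is
  harmless because \<open>disc\<close> holds for all subsets simultaneously.\<close>

lemma bounded_coeff_discrepancy:
  fixes U :: "'a \<Rightarrow> 'a \<Rightarrow> real" and a :: real
  assumes fin: "finite C" and a: "a \<ge> 0"
    and disc: "\<forall>S T. S \<subseteq> C \<longrightarrow> T \<subseteq> C \<longrightarrow> \<bar>\<Sum>i\<in>S. \<Sum>j\<in>T. U i j\<bar> \<le> a * sqrt (card S * card T)"
    and ST: "S \<subseteq> C" "T \<subseteq> C"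
    and f: "\<And>i. i \<in> S \<Longrightarrow> \<bar>f i\<bar> \<le> 1" and g: "\<And>j. j \<in> T \<Longrightarrow> \<bar>g j\<bar> \<le> 1"
  shows "\<bar>\<Sum>i\<in>S. \<Sum>j\<in>T. U i j * f i * g j\<bar> \<le> 4 * a * sqrt (card S * card T)"
proof -
  have fST: "finite S" "finite T" using ST fin finite_subset by auto
  have "\<exists>S'\<subseteq>S. \<bar>\<Sum>i\<in>S. f i * (\<Sum>j\<in>T. U i j * g j)\<bar> \<le> 2 * \<bar>\<Sum>i\<in>S'. \<Sum>j\<in>T. U i j * g j\<bar>"
    by (rule sum_bounded_coeff_le_subset_sum[OF fST(1)]) (rule f)
  then obtain S' where S': "S' \<subseteq> S"
    "\<bar>\<Sum>i\<in>S. f i * (\<Sum>j\<in>T. U i j * g j)\<bar> \<le> 2 * \<bar>\<Sum>i\<in>S'. \<Sum>j\<in>T. U i j * g j\<bar>"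
    by (elim exE conjE)
  have "\<exists>T'\<subseteq>T. \<bar>\<Sum>j\<in>T. g j * (\<Sum>i\<in>S'. U i j)\<bar> \<le> 2 * \<bar>\<Sum>j\<in>T'. \<Sum>i\<in>S'. U i j\<bar>"
    by (rule sum_bounded_coeff_le_subset_sum[OF fST(2)]) (rule g)
  then obtain T' where T': "T' \<subseteq> T"
    "\<bar>\<Sum>j\<in>T. g j * (\<Sum>i\<in>S'. U i j)\<bar> \<le> 2 * \<bar>\<Sum>j\<in>T'. \<Sum>i\<in>S'. U i j\<bar>"
    by (elim exE conjE)
  have "(\<Sum>i\<in>S. \<Sum>j\<in>T. U i j * f i * g j) = (\<Sum>i\<in>S. f i * (\<Sum>j\<in>T. U i j * g j))"
    unfolding sum_distrib_left by (intro sum.cong refl) (simp add: mult_ac)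
  then have "\<bar>\<Sum>i\<in>S. \<Sum>j\<in>T. U i j * f i * g j\<bar> \<le> 2 * \<bar>\<Sum>i\<in>S'. \<Sum>j\<in>T. U i j * g j\<bar>"
    using S'(2) by simp
  also have "(\<Sum>i\<in>S'. \<Sum>j\<in>T. U i j * g j) = (\<Sum>j\<in>T. g j * (\<Sum>i\<in>S'. U i j))"
    by (subst sum.swap) (simp add: sum_distrib_left mult.commute)
  also have "2 * \<bar>\<dots>\<bar> \<le> 2 * (2 * \<bar>\<Sum>j\<in>T'. \<Sum>i\<in>S'. U i j\<bar>)"
    using T'(2) by simp
  also have "(\<Sum>j\<in>T'. \<Sum>i\<in>S'. U i j) = (\<Sum>i\<in>S'. \<Sum>j\<in>T'. U i j)" by (rule sum.swap)
  also have "2 * (2 * \<bar>\<dots>\<bar>) \<le> 2 * (2 * (a * sqrt (card S' * card T')))"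
    using disc[rule_format, of S' T'] S'(1) T'(1) ST by (intro mult_left_mono) auto
  also have "sqrt (card S' * card T') \<le> sqrt (card S * card T)"
    using S'(1) T'(1) fST by (simp add: mult_mono card_mono)
  finally show ?thesis using a by (simp add: mult_left_mono)
qed

text \<open>
  Split the pairs \<open>(i, j)\<close> by the dyadic scales of \<open>\<bar>x i\<bar>\<close> and \<open>\<bar>x j\<bar>\<close>: scales at most \<open>r\<close> apart
  are controlled by the discrepancy, the others by the row sums.
\<close>

lemma quadratic_form_bound_of_discrepancy:
  fixes U :: "'a \<Rightarrow> 'a \<Rightarrow> real" and x :: "'a \<Rightarrow> real" and a D :: real and r :: nat
  assumes fin: "finite C" and a: "a \<ge> 0"
    and disc: "\<forall>S T. S \<subseteq> C \<longrightarrow> T \<subseteq> C \<longrightarrow> \<bar>\<Sum>i\<in>S. \<Sum>j\<in>T. U i j\<bar> \<le> a * sqrt (card S * card T)"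
    and row: "\<And>i. i \<in> C \<Longrightarrow> (\<Sum>j\<in>C. \<bar>U i j\<bar> + \<bar>U j i\<bar>) \<le> D"
  shows "\<bar>\<Sum>i\<in>C. \<Sum>j\<in>C. U i j * x i * x j\<bar> \<le> (16 * (2 * r + 1) * a + D / 2 ^ r) * (\<Sum>i\<in>C. (x i)\<^sup>2)"
proof -
  \<comment> \<open>Zeros are removed since they have no dyadic scale; the scale
    \<open>\<kappa>\<close> is an integer of either sign.\<close>
  define C' where "C' = {i \<in> C. x i \<noteq> 0}"
  define \<kappa> where "\<kappa> = (\<lambda>i. \<lfloor>log 2 \<bar>x i\<bar>\<rfloor>)"
  define p where "p = (\<lambda>k::int. 2 powr real_of_int k)"
  define L where "L = (\<lambda>k. {i \<in> C'. \<kappa> i = k})"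
  define K where "K = \<kappa> ` C'"
  define m where "m = (\<lambda>k. \<Sum>i\<in>L k. (x i)\<^sup>2)"
  have fin': "finite C'" "finite K" "C' \<subseteq> C" using fin by (auto simp: C'_def K_def)
  have finL: "finite (L k)" "L k \<subseteq> C" for k using fin' by (auto simp: L_def)
  have p_pos: "p k > 0" for k by (simp add: p_def)
  have scale: "p (\<kappa> i) \<le> \<bar>x i\<bar>" "\<bar>x i\<bar> < 2 * p (\<kappa> i)" if "i \<in> C'" for i
  proof -
    have pos: "\<bar>x i\<bar> > 0" using that by (simp add: C'_def)
    have "p (\<kappa> i) \<le> 2 powr (log 2 \<bar>x i\<bar>)" unfolding p_def \<kappa>_def by simp
    then show "p (\<kappa> i) \<le> \<bar>x i\<bar>" using pos by simp
    have "2 powr (log 2 \<bar>x i\<bar>) < 2 powr (real_of_int (\<kappa> i) + 1)" unfolding \<kappa>_def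
      by (intro powr_less_mono) linarith+
    then show "\<bar>x i\<bar> < 2 * p (\<kappa> i)" using pos by (simp add: p_def powr_add)
  qed
  have regroup: "(\<Sum>k\<in>K. \<Sum>i\<in>L k. h i) = (\<Sum>i\<in>C'. h i)" for h :: "'a \<Rightarrow> real"
    unfolding L_def K_def using fin'(1) by (simp add: sum.image_gen[symmetric])
  have sum_m: "(\<Sum>k\<in>K. m k) = (\<Sum>i\<in>C. (x i)\<^sup>2)"
  proof -
    have "(\<Sum>k\<in>K. m k) = (\<Sum>i\<in>C'. (x i)\<^sup>2)" unfolding m_def by (rule regroup)
    also have "\<dots> = (\<Sum>i\<in>C. (x i)\<^sup>2)"
      using fin by (intro sum.mono_neutral_left) (auto simp: C'_def)
    finally show ?thesis .
  qed
  have m_nonneg: "m k \<ge> 0" for k unfolding m_def by (intro sum_nonneg) simp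
  have p_card: "(p k)\<^sup>2 * card (L k) \<le> m k" for k
  proof -
    have "(p k)\<^sup>2 * card (L k) = (\<Sum>i\<in>L k. (p k)\<^sup>2)" by simp
    also have "\<dots> \<le> m k" unfolding m_def
    proof (intro sum_mono)
      fix i assume "i \<in> L k"
      then have "i \<in> C'" "\<kappa> i = k" by (auto simp: L_def)
      then have "p k \<le> \<bar>x i\<bar>" using scale by auto
      then have "(p k)\<^sup>2 \<le> \<bar>x i\<bar>\<^sup>2" using p_pos[of k] by (intro power_mono) auto
      then show "(p k)\<^sup>2 \<le> (x i)\<^sup>2" by simp
    qed
    finally show ?thesis .
  qed
  \<comment> \<open>Normalizing by \<open>2 * p k\<close> and \<open>2 * p l\<close> costs 4,
    bounded coefficients cost another 4, and 2 u v <= u^2 + v^2 returns a half: hence 8. A level of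
    size \<open>p k\<close> has mass at least (p k)^2 times its cardinality, which absorbs the
    square root.\<close>
  have block: "\<bar>\<Sum>i\<in>L k. \<Sum>j\<in>L l. U i j * x i * x j\<bar> \<le> 8 * a * (m k + m l)" for k l
  proof -
    have b: "\<bar>x i / (2 * p k)\<bar> \<le> 1" if "i \<in> L k" for i k
      using scale(2)[of i] p_pos[of k] that by (auto simp: L_def field_simps)
    have "(\<Sum>i\<in>L k. \<Sum>j\<in>L l. U i j * x i * x j) =
      4 * (p k * p l) * (\<Sum>i\<in>L k. \<Sum>j\<in>L l. U i j * (x i / (2 * p k)) * (x j / (2 * p l)))"
      unfolding sum_distrib_left using p_pos[of k] p_pos[of l]
      by (intro sum.cong refl) (simp add: field_simps)
    then have "\<bar>\<Sum>i\<in>L k. \<Sum>j\<in>L l. U i j * x i * x j\<bar> =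
      4 * (p k * p l) * \<bar>\<Sum>i\<in>L k. \<Sum>j\<in>L l. U i j * (x i / (2 * p k)) * (x j / (2 * p l))\<bar>"
      using p_pos[of k] p_pos[of l] by (simp add: abs_mult)
    also have "\<dots> \<le> 4 * (p k * p l) * (4 * a * sqrt (card (L k) * card (L l)))"
    proof (rule mult_left_mono)
      show "\<bar>\<Sum>i\<in>L k. \<Sum>j\<in>L l. U i j * (x i / (2 * p k)) * (x j / (2 * p l))\<bar>
          \<le> 4 * a * sqrt (card (L k) * card (L l))"
        by (rule bounded_coeff_discrepancy[OF fin a disc finL(2) finL(2)]; erule b)
    qed (use p_pos[of k] p_pos[of l] in simp)
    also have "\<dots> = 8 * a * (2 * (p k * sqrt (card (L k))) * (p l * sqrt (card (L l))))"
      by (simp add: real_sqrt_mult)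
    also have "2 * (p k * sqrt (card (L k))) * (p l * sqrt (card (L l)))
        \<le> (p k * sqrt (card (L k)))\<^sup>2 + (p l * sqrt (card (L l)))\<^sup>2"
      by (rule sum_squares_bound)
    also have "\<dots> \<le> m k + m l"
      using p_card[of k] p_card[of l] by (simp add: power_mult_distrib)
    finally show ?thesis using a by (simp add: mult_left_mono)
  qed
  \<comment> \<open>Each level has at most 2r + 1 near levels, however many levels occur, so the sum
    of \<open>m k + m l\<close> over near pairs is a bounded multiple of the total mass.\<close>
  define near where "near = (\<lambda>k l. \<bar>k - l\<bar> \<le> int r)"
  have near_card: "card {l \<in> K. near k l} \<le> 2 * r + 1" for k
  proof -
    have "{l \<in> K. near k l} \<subseteq> {k - int r..k + int r}" by (auto simp: near_def)
    from card_mono[OF _ this] show ?thesis by simp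
  qed
  have "\<bar>\<Sum>k\<in>K. \<Sum>l\<in>K. if near k l then (\<Sum>i\<in>L k. \<Sum>j\<in>L l. U i j * x i * x j) else 0\<bar>
     \<le> (\<Sum>k\<in>K. \<Sum>l\<in>K. \<bar>if near k l then (\<Sum>i\<in>L k. \<Sum>j\<in>L l. U i j * x i * x j) else 0\<bar>)"
    by (intro order_trans[OF sum_abs] sum_mono sum_abs)
  also have "\<dots> \<le> (\<Sum>k\<in>K. \<Sum>l\<in>K. (if near k l then 8 * a * m k else 0) + (if near k l then 8 * a * m l else 0))"
    using block by (intro sum_mono) (simp add: distrib_left)
  also have "\<dots> = (\<Sum>k\<in>K. \<Sum>l\<in>K. if near k l then 8 * a * m k else 0)
      + (\<Sum>k\<in>K. \<Sum>l\<in>K. if near k l then 8 * a * m l else 0)"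
    by (simp add: sum.distrib)
  also have "(\<Sum>k\<in>K. \<Sum>l\<in>K. if near k l then 8 * a * m l else 0)
      = (\<Sum>k\<in>K. \<Sum>l\<in>K. if near k l then 8 * a * m k else 0)"
    by (subst sum.swap) (simp add: near_def abs_minus_commute)
  also have "\<dots> + \<dots> = (\<Sum>k\<in>K. 16 * a * m k * card {l \<in> K. near k l})"
  proof -
    have "(\<Sum>l\<in>K. if near k l then 8 * a * m k else 0) = 8 * a * m k * card {l \<in> K. near k l}" for k
      by (simp add: sum.inter_filter[OF fin'(2), symmetric])
    then show ?thesis by (simp add: sum.distrib[symmetric] mult_ac)
  qed
  also have "\<dots> \<le> (\<Sum>k\<in>K. 16 * a * m k * real (2 * r + 1))"
  proof (intro sum_mono mult_left_mono)
    show "real (card {l \<in> K. near k l}) \<le> real (2 * r + 1)" for k using near_card[of k] by linarith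
  qed (use a m_nonneg in simp)
  also have "\<dots> = 16 * (2 * r + 1) * a * (\<Sum>i\<in>C. (x i)\<^sup>2)"
    unfolding sum_m[symmetric] sum_distrib_left by (intro sum.cong refl) (simp add: algebra_simps)
  finally have near_le: "\<bar>\<Sum>k\<in>K. \<Sum>l\<in>K. if near k l then (\<Sum>i\<in>L k. \<Sum>j\<in>L l. U i j * x i * x j) else 0\<bar>
      \<le> 16 * (2 * r + 1) * a * (\<Sum>i\<in>C. (x i)\<^sup>2)" .
  have near_eq: "(\<Sum>k\<in>K. \<Sum>l\<in>K. if near k l then (\<Sum>i\<in>L k. \<Sum>j\<in>L l. U i j * x i * x j) else 0)
     = (\<Sum>i\<in>C'. \<Sum>j\<in>C'. if near (\<kappa> i) (\<kappa> j) then U i j * x i * x j else 0)"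
  proof -
    have "(\<Sum>k\<in>K. \<Sum>l\<in>K. if near k l then (\<Sum>i\<in>L k. \<Sum>j\<in>L l. U i j * x i * x j) else 0)
      = (\<Sum>k\<in>K. \<Sum>l\<in>K. \<Sum>i\<in>L k. \<Sum>j\<in>L l. if near (\<kappa> i) (\<kappa> j) then U i j * x i * x j else 0)"
      by (intro sum.cong refl) (auto simp: L_def)
    also have "\<dots> = (\<Sum>k\<in>K. \<Sum>i\<in>L k. \<Sum>l\<in>K. \<Sum>j\<in>L l. if near (\<kappa> i) (\<kappa> j) then U i j * x i * x j else 0)"
      by (rule sum.cong[OF refl], rule sum.swap)
    finally show ?thesis unfolding regroup .
  qed
  have far: "\<bar>if near (\<kappa> i) (\<kappa> j) then 0 else U i j * x i * x j\<bar> \<le> \<bar>U i j\<bar> * ((x i)\<^sup>2 + (x j)\<^sup>2) / 2 ^ r"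
    if ij: "i \<in> C'" "j \<in> C'" for i j
  proof (cases "near (\<kappa> i) (\<kappa> j)")
    case False
    \<comment> \<open>Rounding to a dyadic scale could lose a factor 2, but the inequality between
      integer levels is strict, so \<kappa> v + 1 <= \<kappa> u - r and nothing is lost.\<close>
    have small: "\<bar>x v\<bar> \<le> \<bar>x u\<bar> / 2 ^ r" if "u \<in> C'" "v \<in> C'" "\<kappa> v + int r < \<kappa> u" for u v
    proof -
      have "\<bar>x v\<bar> \<le> 2 * p (\<kappa> v)" using scale(2) that by (simp add: less_imp_le)
      also have "\<dots> = p (\<kappa> v + 1)" by (simp add: p_def powr_add)
      also have "\<dots> \<le> p (\<kappa> u - int r)" using that(3) by (simp add: p_def)
      also have "\<dots> = p (\<kappa> u) / 2 ^ r" by (simp add: p_def powr_diff powr_realpow)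
      also have "\<dots> \<le> \<bar>x u\<bar> / 2 ^ r" using scale(1) that by (simp add: divide_right_mono)
      finally show ?thesis .
    qed
    have prod: "\<bar>x i * x j\<bar> \<le> ((x i)\<^sup>2 + (x j)\<^sup>2) / 2 ^ r"
    proof (cases "\<kappa> j + int r < \<kappa> i")
      case True
      have "\<bar>x i * x j\<bar> \<le> \<bar>x i\<bar> * (\<bar>x i\<bar> / 2 ^ r)"
        unfolding abs_mult using small[OF ij True] by (intro mult_left_mono) auto
      also have "\<dots> \<le> ((x i)\<^sup>2 + (x j)\<^sup>2) / 2 ^ r" by (simp add: power2_eq_square divide_right_mono)
      finally show ?thesis .
    next
      case 2: False
      then have "\<kappa> i + int r < \<kappa> j" using False by (simp add: near_def)
      from small[OF ij(2,1) this] have "\<bar>x i * x j\<bar> \<le> (\<bar>x j\<bar> / 2 ^ r) * \<bar>x j\<bar>"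
        unfolding abs_mult by (intro mult_right_mono) auto
      also have "\<dots> \<le> ((x i)\<^sup>2 + (x j)\<^sup>2) / 2 ^ r" by (simp add: power2_eq_square divide_right_mono)
      finally show ?thesis .
    qed
    have "\<bar>U i j * x i * x j\<bar> = \<bar>U i j\<bar> * \<bar>x i * x j\<bar>" by (simp add: abs_mult)
    also have "\<dots> \<le> \<bar>U i j\<bar> * (((x i)\<^sup>2 + (x j)\<^sup>2) / 2 ^ r)" by (intro mult_left_mono prod) simp
    finally show ?thesis using False by simp
  qed simp
  have "\<bar>\<Sum>i\<in>C'. \<Sum>j\<in>C'. if near (\<kappa> i) (\<kappa> j) then 0 else U i j * x i * x j\<bar>
      \<le> (\<Sum>i\<in>C'. \<Sum>j\<in>C'. \<bar>if near (\<kappa> i) (\<kappa> j) then 0 else U i j * x i * x j\<bar>)"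
    by (intro order_trans[OF sum_abs] sum_mono sum_abs)
  also have "\<dots> \<le> (\<Sum>i\<in>C'. \<Sum>j\<in>C'. \<bar>U i j\<bar> * ((x i)\<^sup>2 + (x j)\<^sup>2) / 2 ^ r)"
    by (intro sum_mono far)
  also have "\<dots> = (\<Sum>i\<in>C'. \<Sum>j\<in>C'. \<bar>U i j\<bar> * (x i)\<^sup>2 / 2 ^ r) + (\<Sum>i\<in>C'. \<Sum>j\<in>C'. \<bar>U i j\<bar> * (x j)\<^sup>2 / 2 ^ r)"
    by (simp add: sum.distrib distrib_left add_divide_distrib)
  also have "(\<Sum>i\<in>C'. \<Sum>j\<in>C'. \<bar>U i j\<bar> * (x j)\<^sup>2 / 2 ^ r) = (\<Sum>i\<in>C'. \<Sum>j\<in>C'. \<bar>U j i\<bar> * (x i)\<^sup>2 / 2 ^ r)"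
    by (rule sum.swap)
  also have "(\<Sum>i\<in>C'. \<Sum>j\<in>C'. \<bar>U i j\<bar> * (x i)\<^sup>2 / 2 ^ r) + \<dots>
     = (\<Sum>i\<in>C'. (\<Sum>j\<in>C'. \<bar>U i j\<bar> + \<bar>U j i\<bar>) * (x i)\<^sup>2 / 2 ^ r)"
    unfolding sum.distrib[symmetric] sum_distrib_right sum_divide_distrib
    by (intro sum.cong refl) (simp add: distrib_right add_divide_distrib)
  also have "\<dots> \<le> (\<Sum>i\<in>C'. D * (x i)\<^sup>2 / 2 ^ r)"
  proof (intro sum_mono divide_right_mono mult_right_mono)
    fix i assume i: "i \<in> C'"
    have "(\<Sum>j\<in>C'. \<bar>U i j\<bar> + \<bar>U j i\<bar>) \<le> (\<Sum>j\<in>C. \<bar>U i j\<bar> + \<bar>U j i\<bar>)"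
      using fin fin' by (intro sum_mono2) auto
    also have "\<dots> \<le> D" using row i fin' by auto
    finally show "(\<Sum>j\<in>C'. \<bar>U i j\<bar> + \<bar>U j i\<bar>) \<le> D" .
  qed auto
  also have "\<dots> = D / 2 ^ r * (\<Sum>i\<in>C'. (x i)\<^sup>2)" by (simp add: sum_distrib_left)
  also have "(\<Sum>i\<in>C'. (x i)\<^sup>2) = (\<Sum>i\<in>C. (x i)\<^sup>2)"
    using fin by (intro sum.mono_neutral_left) (auto simp: C'_def)
  finally have far_le: "\<bar>\<Sum>i\<in>C'. \<Sum>j\<in>C'. if near (\<kappa> i) (\<kappa> j) then 0 else U i j * x i * x j\<bar>
      \<le> D / 2 ^ r * (\<Sum>i\<in>C. (x i)\<^sup>2)" .
  have "(\<Sum>i\<in>C. \<Sum>j\<in>C. U i j * x i * x j) = (\<Sum>i\<in>C'. \<Sum>j\<in>C'. U i j * x i * x j)"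
  proof -
    have "(\<Sum>j\<in>C. U i j * x i * x j) = (\<Sum>j\<in>C'. U i j * x i * x j)" for i
      using fin by (intro sum.mono_neutral_right) (auto simp: C'_def)
    then show ?thesis
      using fin by (auto intro!: sum.mono_neutral_right simp: C'_def)
  qed
  also have "\<dots> = (\<Sum>i\<in>C'. \<Sum>j\<in>C'. if near (\<kappa> i) (\<kappa> j) then U i j * x i * x j else 0)
      + (\<Sum>i\<in>C'. \<Sum>j\<in>C'. if near (\<kappa> i) (\<kappa> j) then 0 else U i j * x i * x j)"
    unfolding sum.distrib[symmetric] by (intro sum.cong refl) simp
  finally show ?thesis
    using near_le far_le unfolding near_eq distrib_right by linarith
qed

text \<open>If one set is at least \<kappa>^2 times larger, the trivial bound by row sums over the
  smaller set A suffices: D |A| <= \<kappa> a |A| = a sqrt (|A| * \<kappa>^2 |A|). The probabilistic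
  estimate is left with pairs of comparable size.\<close>

lemma discrepancy_of_balanced:
  fixes U :: "'a \<Rightarrow> 'a \<Rightarrow> real" and a \<kappa> D :: real
  assumes fin: "finite C" and a: "a \<ge> 0" and \<kappa>: "\<kappa> \<ge> 0" "D \<le> \<kappa> * a"
    and row: "\<And>i. i \<in> C \<Longrightarrow> (\<Sum>j\<in>C. \<bar>U i j\<bar> + \<bar>U j i\<bar>) \<le> D"
    and bal: "\<forall>S T. S \<subseteq> C \<longrightarrow> T \<subseteq> C \<longrightarrow> S \<noteq> {} \<longrightarrow> T \<noteq> {} \<longrightarrow>
        card S \<le> \<kappa>\<^sup>2 * card T \<longrightarrow> card T \<le> \<kappa>\<^sup>2 * card S \<longrightarrow>
        \<bar>\<Sum>i\<in>S. \<Sum>j\<in>T. U i j\<bar> \<le> a * sqrt (card S * card T)"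
    and ST: "S \<subseteq> C" "T \<subseteq> C"
  shows "\<bar>\<Sum>i\<in>S. \<Sum>j\<in>T. U i j\<bar> \<le> a * sqrt (card S * card T)"
proof -
  have abs_le: "\<bar>\<Sum>i\<in>A. \<Sum>j\<in>B. V i j\<bar> \<le> a * sqrt (card A * card B)"
    if A: "A \<subseteq> C" "B \<subseteq> C" and V: "\<And>i. i \<in> C \<Longrightarrow> (\<Sum>j\<in>C. \<bar>V i j\<bar>) \<le> D"
      and large: "\<kappa>\<^sup>2 * card A \<le> card B" for A B and V :: "'a \<Rightarrow> 'a \<Rightarrow> real"
  proof -
    have "\<bar>\<Sum>i\<in>A. \<Sum>j\<in>B. V i j\<bar> \<le> (\<Sum>i\<in>A. \<Sum>j\<in>B. \<bar>V i j\<bar>)"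
      by (intro order_trans[OF sum_abs] sum_mono sum_abs)
    also have "\<dots> \<le> (\<Sum>i\<in>A. D)"
    proof (intro sum_mono)
      fix i assume "i \<in> A"
      have "(\<Sum>j\<in>B. \<bar>V i j\<bar>) \<le> (\<Sum>j\<in>C. \<bar>V i j\<bar>)" using fin A by (intro sum_mono2) auto
      also have "\<dots> \<le> D" using V A \<open>i \<in> A\<close> by auto
      finally show "(\<Sum>j\<in>B. \<bar>V i j\<bar>) \<le> D" .
    qed
    also have "\<dots> \<le> card A * (\<kappa> * a)" using \<kappa> by (simp add: mult_left_mono)
    also have "\<dots> = a * sqrt (card A * (\<kappa>\<^sup>2 * card A))"
      using \<kappa> by (simp add: real_sqrt_mult)
    also have "\<dots> \<le> a * sqrt (card A * card B)"
      using large a by (auto intro!: mult_left_mono)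
    finally show ?thesis .
  qed
  have rows: "(\<Sum>j\<in>C. \<bar>U i j\<bar>) \<le> D" "(\<Sum>j\<in>C. \<bar>U j i\<bar>) \<le> D" if "i \<in> C" for i
  proof -
    have "(\<Sum>j\<in>C. \<bar>U i j\<bar>) + (\<Sum>j\<in>C. \<bar>U j i\<bar>) \<le> D" using row[OF that] by (simp add: sum.distrib)
    moreover have "(\<Sum>j\<in>C. \<bar>U i j\<bar>) \<ge> 0" "(\<Sum>j\<in>C. \<bar>U j i\<bar>) \<ge> 0" by (intro sum_nonneg; simp)+
    ultimately show "(\<Sum>j\<in>C. \<bar>U i j\<bar>) \<le> D" "(\<Sum>j\<in>C. \<bar>U j i\<bar>) \<le> D" by linarith+
  qed
  consider "S = {} \<or> T = {}" | "\<kappa>\<^sup>2 * card S \<le> card T" | "\<kappa>\<^sup>2 * card T \<le> card S"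
    | "S \<noteq> {}" "T \<noteq> {}" "card S \<le> \<kappa>\<^sup>2 * card T" "card T \<le> \<kappa>\<^sup>2 * card S"
    by linarith
  then show ?thesis
  proof cases
    case 1
    then show ?thesis by auto
  next
    case 2
    show ?thesis by (rule abs_le[OF ST _ 2]) (rule rows)
  next
    case 3
    have "\<bar>\<Sum>j\<in>T. \<Sum>i\<in>S. U i j\<bar> \<le> a * sqrt (card T * card S)"
      by (rule abs_le[OF ST(2,1) _ 3]) (rule rows)
    then show ?thesis by (subst sum.swap) (simp add: mult.commute)
  next
    case 4
    then show ?thesis using bal[rule_format, OF ST 4] by simp
  qed
qed

text \<open>After centring \<open>x\<close> to \<open>y\<close>, the energy is the degree form minus
  the adjacency form. Off the diagonal the adjacency matrix is U + U^T + p (J - I), with J the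
  all-ones matrix: J vanishes on \<open>y\<close>, -p I helps, and the two copies of
  \<open>U\<close> cost the factor 2 in front of the norm bound.\<close>

lemma spectral_gap_of_discrepancy:
  fixes w :: "nat \<Rightarrow> nat \<Rightarrow> real" and a p \<kappa> dmin dmax :: real and n r :: nat
  assumes fin: "finite C" and C: "card C = n" "n > 0" and a: "a \<ge> 0" and p: "p \<ge> 0"
    and sym: "\<And>i j. i \<in> C \<Longrightarrow> j \<in> C \<Longrightarrow> w i j = w j i"
    and nonneg: "\<And>i j. i \<in> C \<Longrightarrow> j \<in> C \<Longrightarrow> 0 \<le> w i j"
    and \<kappa>: "\<kappa> \<ge> 0" "dmax + n * p \<le> \<kappa> * a"
    and bal: "\<forall>S T. S \<subseteq> C \<longrightarrow> T \<subseteq> C \<longrightarrow> S \<noteq> {} \<longrightarrow> T \<noteq> {} \<longrightarrow>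
        card S \<le> \<kappa>\<^sup>2 * card T \<longrightarrow> card T \<le> \<kappa>\<^sup>2 * card S \<longrightarrow>
        \<bar>\<Sum>i\<in>S. \<Sum>j\<in>T. if i < j then w i j - p else 0\<bar> \<le> a * sqrt (card S * card T)"
    and deg: "\<And>i. i \<in> C \<Longrightarrow> dmin \<le> (\<Sum>j\<in>C - {i}. w i j)" "\<And>i. i \<in> C \<Longrightarrow> (\<Sum>j\<in>C - {i}. w i j) \<le> dmax"
  shows "(dmin - 2 * (16 * (2 * r + 1) * a + (dmax + n * p) / 2 ^ r))
      * ((\<Sum>i\<in>C. (x i)\<^sup>2) - (\<Sum>i\<in>C. x i)\<^sup>2 / n)
      \<le> (\<Sum>i\<in>C. \<Sum>j\<in>C. w i j * (x i - x j)\<^sup>2) / 2"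
proof -
  define U where "U = (\<lambda>i j. if i < j then w i j - p else 0)"
  define v where "v = (\<lambda>i j. if i = j then 0 else w i j)"
  define y where "y = (\<lambda>i. x i - (\<Sum>i\<in>C. x i) / n)"
  define B where "B = 16 * (2 * r + 1) * a + (dmax + n * p) / 2 ^ r"
  have diff: "x i - x j = y i - y j" for i j by (simp add: y_def)
  have y0: "(\<Sum>i\<in>C. y i) = 0" using C by (simp add: y_def sum_subtractf)
  have y2: "(\<Sum>i\<in>C. (y i)\<^sup>2) = (\<Sum>i\<in>C. (x i)\<^sup>2) - (\<Sum>i\<in>C. x i)\<^sup>2 / n"
  proof -
    define s where "s = (\<Sum>i\<in>C. x i)"
    have "(\<Sum>i\<in>C. (y i)\<^sup>2) = (\<Sum>i\<in>C. (x i)\<^sup>2 - 2 * (s / n) * x i + (s / n)\<^sup>2)"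
      unfolding y_def s_def[symmetric] by (intro sum.cong refl) (simp add: power2_diff algebra_simps)
    also have "\<dots> = (\<Sum>i\<in>C. (x i)\<^sup>2) - 2 * (s / n) * s + n * (s / n)\<^sup>2"
      using C unfolding sum.distrib sum_subtractf sum_distrib_left[symmetric] s_def[symmetric] by simp
    also have "\<dots> = (\<Sum>i\<in>C. (x i)\<^sup>2) - s\<^sup>2 / n" using C by (simp add: power2_eq_square field_simps)
    finally show ?thesis by (simp add: s_def)
  qed
  have vsplit: "v i j = U i j + U j i + (if i = j then 0 else p)" if "i \<in> C" "j \<in> C" for i j
    using sym[OF that] by (auto simp: U_def v_def)
  have vdeg: "(\<Sum>j\<in>C. v i j * c) = (\<Sum>j\<in>C - {i}. w i j) * c" if "i \<in> C" for i and c :: real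
  proof -
    have "(\<Sum>j\<in>C - {i}. w i j * c) = (\<Sum>j\<in>C. v i j * c)"
      using that fin by (intro sum.mono_neutral_cong_left) (auto simp: v_def)
    then show ?thesis by (simp add: sum_distrib_right)
  qed
  have row: "(\<Sum>j\<in>C. \<bar>U i j\<bar> + \<bar>U j i\<bar>) \<le> dmax + n * p" if i: "i \<in> C" for i
  proof -
    have "(\<Sum>j\<in>C. \<bar>U i j\<bar> + \<bar>U j i\<bar>) \<le> (\<Sum>j\<in>C. v i j * 1 + p)"
    proof (intro sum_mono)
      fix j assume j: "j \<in> C"
      have "w i j \<ge> 0" "w j i \<ge> 0" "w i j = w j i" using nonneg sym i j by auto
      then show "\<bar>U i j\<bar> + \<bar>U j i\<bar> \<le> v i j * 1 + p"
        using p by (cases i j rule: linorder_cases) (auto simp: U_def v_def)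
    qed
    also have "\<dots> \<le> dmax + n * p"
      unfolding sum.distrib vdeg[OF i] using C deg(2)[OF i] by simp
    finally show ?thesis .
  qed
  have disc: "\<bar>\<Sum>i\<in>S. \<Sum>j\<in>T. U i j\<bar> \<le> a * sqrt (card S * card T)" if "S \<subseteq> C" "T \<subseteq> C" for S T
    by (rule discrepancy_of_balanced[OF fin a \<kappa> row])
      (use bal that in \<open>simp_all add: U_def\<close>)
  have U: "\<bar>\<Sum>i\<in>C. \<Sum>j\<in>C. U i j * y i * y j\<bar> \<le> B * (\<Sum>i\<in>C. (y i)\<^sup>2)"
    unfolding B_def
    by (rule quadratic_form_bound_of_discrepancy[OF fin a]) (use disc row in auto)
  have vyy: "(\<Sum>i\<in>C. \<Sum>j\<in>C. v i j * y i * y j)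
     = 2 * (\<Sum>i\<in>C. \<Sum>j\<in>C. U i j * y i * y j) - p * (\<Sum>i\<in>C. (y i)\<^sup>2)"
  proof -
    have "(\<Sum>i\<in>C. \<Sum>j\<in>C. v i j * y i * y j) = (\<Sum>i\<in>C. \<Sum>j\<in>C.
        (U i j * y i * y j + U j i * y j * y i) + (p * (y i * y j) - (if i = j then p * (y i * y j) else 0)))"
      by (intro sum.cong refl) (simp add: vsplit algebra_simps)
    also have "\<dots> = (\<Sum>i\<in>C. \<Sum>j\<in>C. U i j * y i * y j) + (\<Sum>i\<in>C. \<Sum>j\<in>C. U j i * y j * y i)
       + (p * ((\<Sum>i\<in>C. y i) * (\<Sum>j\<in>C. y j)) - p * (\<Sum>i\<in>C. (y i)\<^sup>2))"
      unfolding sum.distrib sum_subtractf sum_product using fin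
      by (simp add: sum_distrib_left sum.delta power2_eq_square)
    also have "(\<Sum>i\<in>C. \<Sum>j\<in>C. U j i * y j * y i) = (\<Sum>i\<in>C. \<Sum>j\<in>C. U i j * y i * y j)"
      by (rule sum.swap)
    finally show ?thesis by (simp add: y0)
  qed
  have "(\<Sum>i\<in>C. \<Sum>j\<in>C. w i j * (x i - x j)\<^sup>2) = (\<Sum>i\<in>C. \<Sum>j\<in>C.
      v i j * (y i)\<^sup>2 + v i j * (y j)\<^sup>2 - 2 * (v i j * y i * y j))"
    unfolding diff by (intro sum.cong refl) (auto simp: v_def power2_eq_square algebra_simps)
  also have "\<dots> = (\<Sum>i\<in>C. \<Sum>j\<in>C. v i j * (y i)\<^sup>2) + (\<Sum>i\<in>C. \<Sum>j\<in>C. v i j * (y j)\<^sup>2)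
      - 2 * (\<Sum>i\<in>C. \<Sum>j\<in>C. v i j * y i * y j)"
    by (simp add: sum.distrib sum_subtractf sum_distrib_left)
  also have "(\<Sum>i\<in>C. \<Sum>j\<in>C. v i j * (y j)\<^sup>2) = (\<Sum>i\<in>C. \<Sum>j\<in>C. v i j * (y i)\<^sup>2)"
  proof (subst sum.swap, intro sum.cong refl)
    fix i j assume "i \<in> C" "j \<in> C"
    then show "v j i * (y i)\<^sup>2 = v i j * (y i)\<^sup>2" using sym by (simp add: v_def)
  qed
  finally have E: "(\<Sum>i\<in>C. \<Sum>j\<in>C. w i j * (x i - x j)\<^sup>2) / 2
     = (\<Sum>i\<in>C. \<Sum>j\<in>C. v i j * (y i)\<^sup>2) - (\<Sum>i\<in>C. \<Sum>j\<in>C. v i j * y i * y j)" by simp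
  have "dmin * (\<Sum>i\<in>C. (y i)\<^sup>2) \<le> (\<Sum>i\<in>C. \<Sum>j\<in>C. v i j * (y i)\<^sup>2)"
    unfolding sum_distrib_left using deg(1) by (intro sum_mono) (simp add: vdeg mult_right_mono)
  moreover have "0 \<le> p * (\<Sum>i\<in>C. (y i)\<^sup>2)" using p by (simp add: sum_nonneg)
  ultimately have "(dmin - 2 * B) * (\<Sum>i\<in>C. (y i)\<^sup>2) \<le> (\<Sum>i\<in>C. \<Sum>j\<in>C. w i j * (x i - x j)\<^sup>2) / 2"
    unfolding E vyy left_diff_distrib using U by linarith
  then show ?thesis unfolding y2 B_def .
qed

section \<open>Chernoff bounds\<close>

text \<open>Termwise comparison of the exponential series with a geometric one, by 2 * 3^n <= (n +
  2)!.\<close>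

lemma exp_minus_one_le_bernstein:
  fixes x :: real
  assumes "0 \<le> x" "x < 3"
  shows "exp x - 1 - x \<le> x\<^sup>2 / (2 * (1 - x / 3))"
proof -
  have fact_ge: "2 * 3 ^ n \<le> (fact (n + 2) :: real)" for n
  proof (induction n)
    case (Suc n)
    have "2 * 3 ^ Suc n = 3 * (2 * 3 ^ n :: real)" by simp
    also have "\<dots> \<le> (real n + 3) * fact (n + 2)" using Suc by (intro mult_mono) auto
    finally show ?case by (simp add: algebra_simps)
  qed simp
  have geo: "(\<lambda>n. x\<^sup>2 / 2 * (x / 3) ^ n) sums (x\<^sup>2 / 2 * (1 / (1 - x / 3)))"
    using assms by (intro sums_mult geometric_sums) simp
  have "exp x - 1 - x = (\<Sum>n. inverse (fact (n + 2)) *\<^sub>R (x ^ (n + 2)))"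
    using exp_first_two_terms[of x] by simp
  also have "\<dots> \<le> (\<Sum>n. x\<^sup>2 / 2 * (x / 3) ^ n)"
  proof (rule suminf_le)
    fix n
    have "inverse (fact (n + 2)) * (x ^ (n + 2)) \<le> inverse (2 * 3 ^ n) * x ^ (n + 2)"
      using fact_ge[of n] assms by (intro mult_right_mono le_imp_inverse_le) auto
    also have "\<dots> = x\<^sup>2 / 2 * (x / 3) ^ n" by (simp add: field_simps power_add power2_eq_square power_divide)
    finally show "inverse (fact (n + 2)) *\<^sub>R (x ^ (n + 2)) \<le> x\<^sup>2 / 2 * (x / 3) ^ n" by simp
  next
    show "summable (\<lambda>n. inverse (fact (n + 2)) *\<^sub>R (x ^ (n + 2)))"
      using summable_exp_generic[of x] by (subst summable_iff_shift) (simp add: divide_inverse mult.commute)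
    show "summable (\<lambda>n. x\<^sup>2 / 2 * (x / 3) ^ n)" using geo by (rule sums_summable)
  qed
  also have "\<dots> = x\<^sup>2 / 2 * (1 / (1 - x / 3))" using geo by (simp add: sums_iff)
  finally show ?thesis by (simp add: divide_simps)
qed

text \<open>Concavity of \<open>ln\<close> between 1 and 1 + y. It serves twice: to pull
  \<epsilon>/2 out of the Chernoff parameter, and to compare a general \<sigma> >= 1 with \<sigma> =
  1.\<close>

lemma ln_one_plus_scaled_ge:
  fixes \<eta> y :: real
  assumes "0 \<le> \<eta>" "\<eta> \<le> 1" "0 \<le> y"
  shows "\<eta> * ln (1 + y) \<le> ln (1 + \<eta> * y)"
proof -
  have "(1 - \<eta>) * ln 1 + \<eta> * ln (1 + y) \<le> ln ((1 - \<eta>) *\<^sub>R 1 + \<eta> *\<^sub>R (1 + y))"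
    using assms by (intro concave_onD[OF ln_concave]) auto
  then show ?thesis by (simp add: algebra_simps)
qed

text \<open>With \<theta> = ln (1 + z) this reads exp \<theta> - 1 - \<theta> <= z \<theta>, which
  makes the variance term of the Chernoff exponent proportional to \<theta>.\<close>

lemma diff_ln_le_mult_ln:
  fixes z :: real
  assumes "0 \<le> z"
  shows "z - ln (1 + z) \<le> z * ln (1 + z)"
proof -
  have "- ln (1 + z) = ln (1 / (1 + z))" using assms by (simp add: ln_div)
  also have "\<dots> \<le> 1 / (1 + z) - 1" using assms by (intro ln_le_minus_one) simp
  also have "\<dots> = - z / (1 + z)" using assms by (simp add: field_simps)
  finally have "z / (1 + z) \<le> ln (1 + z)" by simp
  then have "z \<le> ln (1 + z) * (1 + z)" using assms by (simp add: pos_divide_le_eq)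
  then show ?thesis by (simp add: algebra_simps)
qed

text \<open>The bound (e n / s)^s; s^s / s! is a single term of the series of e^s.\<close>

lemma binomial_le_exp:
  assumes "1 \<le> s" "s \<le> n"
  shows "real (n choose s) \<le> exp (s * (1 + ln (n / s)))"
proof -
  have "real (n choose s) * fact s \<le> n ^ s"
    using binomial_fact_pow[of n s] by (metis of_nat_fact of_nat_le_iff of_nat_mult of_nat_power)
  then have a: "real (n choose s) \<le> n ^ s / fact s" by (simp add: field_simps)
  have "s ^ s / fact s \<le> exp (real s)"
  proof -
    have "(\<Sum>k\<in>{s}. inverse (fact k) *\<^sub>R real s ^ k) \<le> (\<Sum>k. inverse (fact k) *\<^sub>R real s ^ k)"
      by (intro sum_le_suminf summable_exp_generic) auto
    then show ?thesis by (simp add: exp_def field_simps)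
  qed
  moreover have "n ^ s / fact s = (s ^ s / fact s) * (n / s) ^ s"
    using assms by (simp add: power_divide)
  ultimately have "n ^ s / fact s \<le> exp (real s) * (n / s) ^ s"
    by (metis mult_right_mono zero_le_power divide_nonneg_nonneg of_nat_0_le_iff)
  also have "(n / s) ^ s = exp (s * ln (n / s))"
    using assms by (simp add: exp_of_nat_mult)
  finally show ?thesis using a by (simp add: distrib_left exp_add)
qed

text \<open>
  With \<open>\<theta> = ln (1 + \<epsilon> n / (2 \<sigma>))\<close> the Chernoff exponent is of the same form for sparse and
  dense sets, so no case distinction on the size is needed.
\<close>

lemma chernoff_exponent_bound:
  fixes d \<epsilon> \<sigma> n :: real
  assumes "0 \<le> d" "0 < \<epsilon>" "\<epsilon> \<le> 1" "0 < \<sigma>" "0 < n"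
  defines "\<theta> \<equiv> ln (1 + \<epsilon> / 2 * (n / \<sigma>))"
  shows "- \<theta> * (\<epsilon> * d * \<sigma>) + d * \<sigma>\<^sup>2 / n * (exp \<theta> - 1 - \<theta>) \<le> - (\<epsilon>\<^sup>2 / 4) * d * (\<sigma> * ln (1 + n / \<sigma>))"
proof -
  \<comment> \<open>Thus z = exp \<theta> - 1. The variance term eats exactly half of the gain
    \<epsilon> d \<sigma> \<theta>; concavity bounds \<theta> in the other half from below by
    \<epsilon>/2 times ln (1 + n/\<sigma>).\<close>
  define z where "z = \<epsilon> / 2 * (n / \<sigma>)"
  have z: "z > 0" using assms by (simp add: z_def)
  have \<theta>: "\<theta> = ln (1 + z)" by (simp add: \<theta>_def z_def)
  have "exp \<theta> - 1 - \<theta> = z - ln (1 + z)" using z by (simp add: \<theta>)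
  also have "\<dots> \<le> z * \<theta>" using diff_ln_le_mult_ln[of z] z by (simp add: \<theta>)
  finally have "d * \<sigma>\<^sup>2 / n * (exp \<theta> - 1 - \<theta>) \<le> d * \<sigma>\<^sup>2 / n * (z * \<theta>)"
    using assms by (intro mult_left_mono) auto
  also have "\<dots> = \<epsilon> / 2 * (d * \<sigma>) * \<theta>"
    using assms by (simp add: z_def power2_eq_square)
  finally have "- \<theta> * (\<epsilon> * d * \<sigma>) + d * \<sigma>\<^sup>2 / n * (exp \<theta> - 1 - \<theta>) \<le> - (\<epsilon> / 2 * (d * \<sigma>) * \<theta>)"
    by (simp add: algebra_simps)
  also have "\<dots> \<le> - (\<epsilon> / 2 * (d * \<sigma>) * (\<epsilon> / 2 * ln (1 + n / \<sigma>)))"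
    using assms ln_one_plus_scaled_ge[of "\<epsilon> / 2" "n / \<sigma>"]
    by (intro le_imp_neg_le mult_left_mono) (auto simp: \<theta>_def)
  finally show ?thesis by (simp add: power2_eq_square algebra_simps)
qed

text \<open>Expresses the number of sets of size \<open>s\<close> on the scale \<sigma> ln (1 +
  n/\<sigma>) of the Chernoff exponent, where \<sigma> is the geometric mean of two set sizes.
  Comparability of \<open>s\<close> and \<sigma> up to \<kappa> costs only a constant.\<close>

lemma binomial_le_exp_scaled:
  fixes \<kappa> \<sigma> :: real
  assumes s: "1 \<le> s" "s \<le> n" "s \<le> \<kappa> * \<sigma>" and \<kappa>: "1 \<le> \<kappa>" and \<sigma>: "0 < \<sigma>" "\<sigma> \<le> n"
    and lower: "\<sigma> \<le> \<kappa> * s"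
  shows "real (n choose s) \<le> exp (\<kappa> * (3 + 2 * ln \<kappa>) * (\<sigma> * ln (1 + n / \<sigma>)))"
proof -
  define l where "l = ln (1 + n / \<sigma>)"
  have npos: "n > 0" using s by linarith
  \<comment> \<open>Since \<sigma> <= n, the logarithm is at least ln 2; this lets the additive
    constant 1 + ln \<kappa> be absorbed into a multiple of \<open>l\<close>.\<close>
  have l2: "1 / 2 \<le> l"
  proof -
    have "ln 2 \<le> l" unfolding l_def using \<sigma> by (intro ln_mono) (simp_all add: field_simps)
    then show ?thesis using ln2_ge_two_thirds by linarith
  qed
  have "n / s \<le> \<kappa> * (n / \<sigma>)"
    using lower s \<sigma> by (simp add: divide_simps mult_left_mono mult.commute mult.left_commute)
  then have "ln (n / s) \<le> ln (\<kappa> * (n / \<sigma>))"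
    using s npos \<sigma> \<kappa> by (subst ln_le_cancel_iff) (auto intro!: divide_pos_pos mult_pos_pos)
  also have "\<dots> = ln \<kappa> + ln (n / \<sigma>)" using \<kappa> npos \<sigma> by (intro ln_mult_pos) auto
  also have "ln (n / \<sigma>) \<le> l" unfolding l_def using npos \<sigma> by (intro ln_mono) auto
  finally have "1 + ln (n / s) \<le> 1 + ln \<kappa> + l" by simp
  also have "\<dots> \<le> (1 + ln \<kappa>) * (2 * l) + l"
    using mult_left_mono[of 1 "2 * l" "1 + ln \<kappa>"] \<kappa> l2 by simp
  also have "\<dots> = (3 + 2 * ln \<kappa>) * l" by (simp add: algebra_simps)
  finally have "1 + ln (n / s) \<le> (3 + 2 * ln \<kappa>) * l" .
  moreover have "(3 + 2 * ln \<kappa>) * l \<ge> 0" using l2 \<kappa> by simp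
  ultimately have "s * (1 + ln (n / s)) \<le> \<kappa> * \<sigma> * ((3 + 2 * ln \<kappa>) * l)"
    using s(3) by (intro order_trans[OF mult_left_mono mult_right_mono]) auto
  then show ?thesis
    using binomial_le_exp[OF s(1,2)] by (simp add: l_def algebra_simps) (meson exp_le_cancel_iff order_trans)
qed

section \<open>Exponential moments of independent Bernoulli variables\<close>

context prob_space
begin

text \<open>The event keeps \<theta> as a factor on both sides, so that \<theta> > 0 gives the upper
  tail and \<theta> < 0 the lower one. The moment 1 + \<rho> (exp \<theta> - 1) is bounded by an
  exponential, as for a Poisson variable.\<close>

lemma chernoff_bernoulli_sum:
  fixes X :: "'i \<Rightarrow> 'a \<Rightarrow> real" and \<theta> u \<rho> :: real
  assumes indep: "indep_vars (\<lambda>_. borel) X E" and fin: "finite E"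
    and X01: "\<And>e \<omega>. e \<in> E \<Longrightarrow> \<omega> \<in> space M \<Longrightarrow> X e \<omega> \<in> {0, 1}"
    and X1: "\<And>e. e \<in> E \<Longrightarrow> prob {\<omega> \<in> space M. X e \<omega> = 1} = \<rho>"
  shows "prob {\<omega> \<in> space M. \<theta> * u \<le> \<theta> * (\<Sum>e\<in>E. X e \<omega>)} \<le> exp (- \<theta> * u + card E * \<rho> * (exp \<theta> - 1))"
proof -
  have meas[measurable]: "X e \<in> borel_measurable M" if "e \<in> E" for e
    using indep that by (simp add: indep_vars_def)
  have bound: "\<bar>exp (\<theta> * X e \<omega>)\<bar> \<le> exp \<bar>\<theta>\<bar>" if "e \<in> E" "\<omega> \<in> space M" for e \<omega>
    using X01[OF that] by (auto simp: )
  have intg: "integrable M (\<lambda>\<omega>. exp (\<theta> * X e \<omega>))" if e: "e \<in> E" for e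
    using bound[OF e] meas[OF e] by (intro integrable_const_bound[where B = "exp \<bar>\<theta>\<bar>"] AE_I2) auto
  have indepY: "indep_vars (\<lambda>_. borel) (\<lambda>e \<omega>. exp (\<theta> * X e \<omega>)) E"
    by (rule indep_vars_compose2[OF indep]) simp
  have E1: "expectation (\<lambda>\<omega>. exp (\<theta> * X e \<omega>)) \<le> exp (\<rho> * (exp \<theta> - 1))" if e: "e \<in> E" for e
  proof -
    let ?A = "{\<omega> \<in> space M. X e \<omega> = 1}"
    have A: "?A \<in> events" using meas[OF e] by measurable
    have "expectation (\<lambda>\<omega>. exp (\<theta> * X e \<omega>)) = expectation (\<lambda>\<omega>. 1 + (exp \<theta> - 1) * indicator ?A \<omega>)"
    proof (rule Bochner_Integration.integral_cong[OF refl])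
      fix \<omega> assume "\<omega> \<in> space M"
      then show "exp (\<theta> * X e \<omega>) = 1 + (exp \<theta> - 1) * indicator ?A \<omega>"
        using X01[OF e, of \<omega>] by (auto simp: indicator_def)
    qed
    also have "\<dots> = 1 + (exp \<theta> - 1) * \<rho>"
      using A X1[OF e] by (simp add: prob_space emeasure_eq_measure)
    also have "\<dots> \<le> exp (\<rho> * (exp \<theta> - 1))" using exp_ge_add_one_self[of "\<rho> * (exp \<theta> - 1)"] by (simp add: mult.commute)
    finally show ?thesis .
  qed
  have "prob {\<omega> \<in> space M. \<theta> * u \<le> \<theta> * (\<Sum>e\<in>E. X e \<omega>)}
      = prob {\<omega> \<in> space M. exp (\<theta> * u) \<le> (\<Prod>e\<in>E. exp (\<theta> * X e \<omega>))}"
    using fin by (simp add: exp_sum[symmetric] sum_distrib_left)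
  also have "\<dots> \<le> expectation (\<lambda>\<omega>. \<Prod>e\<in>E. exp (\<theta> * X e \<omega>)) / exp (\<theta> * u)"
  proof (rule integral_Markov_inequality_measure)
    show "integrable M (\<lambda>\<omega>. \<Prod>e\<in>E. exp (\<theta> * X e \<omega>))"
      by (rule indep_vars_integrable[OF fin indepY intg])
  qed (auto intro!: prod_nonneg)
  also have "expectation (\<lambda>\<omega>. \<Prod>e\<in>E. exp (\<theta> * X e \<omega>)) = (\<Prod>e\<in>E. expectation (\<lambda>\<omega>. exp (\<theta> * X e \<omega>)))"
    by (rule indep_vars_lebesgue_integral[OF fin indepY intg])
  also have "\<dots> / exp (\<theta> * u) \<le> (\<Prod>e\<in>E. exp (\<rho> * (exp \<theta> - 1))) / exp (\<theta> * u)"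
    by (intro divide_right_mono prod_mono conjI E1 integral_nonneg_AE AE_I2) auto
  also have "(\<Prod>e\<in>E. exp (\<rho> * (exp \<theta> - 1))) = exp (card E * \<rho> * (exp \<theta> - 1))"
    by (simp add: exp_of_nat_mult mult.assoc)
  also have "\<dots> / exp (\<theta> * u) = exp (- \<theta> * u + card E * \<rho> * (exp \<theta> - 1))"
    by (simp add: exp_diff)
  finally show ?thesis .
qed

text \<open>The lower tail has exponent exp (-\<theta>) - 1 + \<theta>, which is at most exp
  \<theta> - 1 - \<theta> because sinh \<theta> >= \<theta>; one bound then covers both tails. Only
  an upper bound \<open>m\<close> on the number of variables enters, since the pairs i < j merely
  form a subset of S x T.\<close>

lemma chernoff_bernoulli_deviation:
  fixes X :: "'i \<Rightarrow> 'a \<Rightarrow> real" and \<theta> u \<rho> :: real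
  assumes indep: "indep_vars (\<lambda>_. borel) X E" and fin: "finite E"
    and X01: "\<And>e \<omega>. e \<in> E \<Longrightarrow> \<omega> \<in> space M \<Longrightarrow> X e \<omega> \<in> {0, 1}"
    and X1: "\<And>e. e \<in> E \<Longrightarrow> prob {\<omega> \<in> space M. X e \<omega> = 1} = \<rho>"
    and \<theta>: "0 < \<theta>" and \<rho>: "0 \<le> \<rho>" and m: "card E \<le> m"
  shows "prob {\<omega> \<in> space M. u \<le> \<bar>\<Sum>e\<in>E. X e \<omega> - \<rho>\<bar>}
    \<le> 2 * exp (- \<theta> * u + m * \<rho> * (exp \<theta> - 1 - \<theta>))"
proof -
  define c where "c = card E * \<rho>"
  define S where "S = (\<lambda>\<omega>. \<Sum>e\<in>E. X e \<omega>)"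
  have meas: "S \<in> borel_measurable M"
    unfolding S_def using indep by (intro borel_measurable_sum) (simp add: indep_vars_def)
  have cm: "c * (exp \<theta> - 1 - \<theta>) \<le> m * \<rho> * (exp \<theta> - 1 - \<theta>)"
  proof -
    have "0 \<le> exp \<theta> - 1 - \<theta>" using exp_ge_add_one_self[of \<theta>] by linarith
    then show ?thesis unfolding c_def using m \<rho> by (intro mult_right_mono) auto
  qed
  have "{\<omega> \<in> space M. u \<le> \<bar>\<Sum>e\<in>E. X e \<omega> - \<rho>\<bar>}
     = {\<omega> \<in> space M. \<theta> * (c + u) \<le> \<theta> * S \<omega>} \<union> {\<omega> \<in> space M. (- \<theta>) * (c - u) \<le> (- \<theta>) * S \<omega>}"
    using \<theta> by (auto simp: sum_subtractf S_def c_def abs_if)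
  then have "prob {\<omega> \<in> space M. u \<le> \<bar>\<Sum>e\<in>E. X e \<omega> - \<rho>\<bar>}
     \<le> prob {\<omega> \<in> space M. \<theta> * (c + u) \<le> \<theta> * S \<omega>} + prob {\<omega> \<in> space M. (- \<theta>) * (c - u) \<le> (- \<theta>) * S \<omega>}"
    using meas by (simp only:) (rule measure_Un_le; measurable)
  also have "prob {\<omega> \<in> space M. \<theta> * (c + u) \<le> \<theta> * S \<omega>} \<le> exp (- \<theta> * u + m * \<rho> * (exp \<theta> - 1 - \<theta>))"
  proof -
    have "prob {\<omega> \<in> space M. \<theta> * (c + u) \<le> \<theta> * S \<omega>} \<le> exp (- \<theta> * (c + u) + card E * \<rho> * (exp \<theta> - 1))"
      unfolding S_def by (rule chernoff_bernoulli_sum) (fact indep fin | erule X01 X1; assumption?)+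
    also have "\<dots> \<le> exp (- \<theta> * u + m * \<rho> * (exp \<theta> - 1 - \<theta>))"
      using cm unfolding c_def[symmetric] by (simp add: algebra_simps)
    finally show ?thesis .
  qed
  also have "prob {\<omega> \<in> space M. (- \<theta>) * (c - u) \<le> (- \<theta>) * S \<omega>} \<le> exp (- \<theta> * u + m * \<rho> * (exp \<theta> - 1 - \<theta>))"
  proof -
    have "prob {\<omega> \<in> space M. (- \<theta>) * (c - u) \<le> (- \<theta>) * S \<omega>}
        \<le> exp (- (- \<theta>) * (c - u) + card E * \<rho> * (exp (- \<theta>) - 1))"
      unfolding S_def by (rule chernoff_bernoulli_sum) (fact indep fin | erule X01 X1; assumption?)+
    also have "- (- \<theta>) * (c - u) + card E * \<rho> * (exp (- \<theta>) - 1) = - \<theta> * u + c * (exp (- \<theta>) - 1 + \<theta>)"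
      unfolding c_def[symmetric] by (simp add: algebra_simps)
    also have "c * (exp (- \<theta>) - 1 + \<theta>) \<le> c * (exp \<theta> - 1 - \<theta>)"
    proof (rule mult_left_mono)
      have "sinh 0 - 0 \<le> sinh \<theta> - \<theta>"
      proof (rule DERIV_nonneg_imp_nondecreasing[where f = "\<lambda>x. sinh x - x"])
        fix x :: real
        have "((\<lambda>x. sinh x - x) has_real_derivative cosh x - 1) (at x)"
          by (auto intro!: derivative_eq_intros)
        then show "\<exists>y. ((\<lambda>x. sinh x - x) has_real_derivative y) (at x) \<and> 0 \<le> y"
          using cosh_real_ge_1[of x] by (intro exI[of _ "cosh x - 1"]) simp
      qed (use \<theta> in simp)
      then show "exp (- \<theta>) - 1 + \<theta> \<le> exp \<theta> - 1 - \<theta>" by (simp add: sinh_def)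
    qed (use \<rho> in \<open>simp add: c_def\<close>)
    also note cm
    finally show ?thesis by simp
  qed
  finally show ?thesis by simp
qed

end

section \<open>The stochastic block model\<close>

text \<open>Weights for the union bound over subsets: each size contributes total weight 1.\<close>

lemma sum_Pow_inverse_binomial:
  assumes "finite C"
  shows "(\<Sum>S\<in>Pow C. 1 / real (card C choose card S)) = real (card C) + 1"
proof -
  have "(\<Sum>S\<in>Pow C. 1 / real (card C choose card S))
      = (\<Sum>k\<le>card C. \<Sum>S | S \<in> Pow C \<and> card S = k. 1 / real (card C choose card S))"
    using assms by (intro sum.group[symmetric]) (auto intro: card_mono)
  also have "\<dots> = (\<Sum>k\<le>card C. 1)"
  proof (intro sum.cong refl)
    fix k assume k: "k \<in> {..card C}"
    have c: "card {S. S \<in> Pow C \<and> card S = k} = card C choose k"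
      using n_subsets[OF assms, of k] by simp
    have pos: "0 < card C choose k" using k by (intro zero_less_binomial) simp
    have "(\<Sum>S | S \<in> Pow C \<and> card S = k. 1 / real (card C choose card S))
        = real (card {S. S \<in> Pow C \<and> card S = k}) * (1 / real (card C choose k))"
      by simp
    also have "\<dots> = 1" unfolding c using pos by simp
    finally show "(\<Sum>S | S \<in> Pow C \<and> card S = k. 1 / real (card C choose card S)) = 1" .
  qed
  also have "\<dots> = real (card C) + 1" by simp
  finally show ?thesis .
qed

lemma (in prob_space) prob_Union_le:
  fixes c :: real
  assumes "finite I" "\<And>i. i \<in> I \<Longrightarrow> F i \<in> events" "\<And>i. i \<in> I \<Longrightarrow> prob (F i) \<le> c"
  shows "prob (\<Union>i\<in>I. F i) \<le> card I * c"
proof -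
  have "prob (\<Union>i\<in>I. F i) \<le> (\<Sum>i\<in>I. prob (F i))" using assms by (intro measure_UNION_le)
  also have "\<dots> \<le> (\<Sum>i\<in>I. c)" using assms by (intro sum_mono)
  finally show ?thesis by simp
qed

locale sbm = prob_space M for M :: "'a measure" +
  fixes n :: nat and \<Gamma> :: "nat \<Rightarrow> nat set" and p q :: real and W :: "'a \<Rightarrow> real mat"
  assumes model: "stochastic_block_model n \<Gamma> p q M W" and n: "n > 0"
begin

abbreviation w :: "nat \<Rightarrow> nat \<Rightarrow> 'a \<Rightarrow> real" where
  "w i j \<omega> \<equiv> W \<omega> $$ (i, j)"

lemma communities: "two_communities n \<Gamma>"
  using model by (simp add: stochastic_block_model_def)

lemma communities_simps:
  "\<Gamma> 1 \<union> \<Gamma> 2 = {..<2 * n}" "\<Gamma> 1 \<inter> \<Gamma> 2 = {}" "card (\<Gamma> 1) = n" "card (\<Gamma> 2) = n"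
  using communities by (simp_all add: two_communities_def)

lemma W_carrier: "\<omega> \<in> space M \<Longrightarrow> W \<omega> \<in> carrier_mat (2 * n) (2 * n)"
  and W_transpose: "\<omega> \<in> space M \<Longrightarrow> transpose_mat (W \<omega>) = W \<omega>"
  and W_elements: "\<omega> \<in> space M \<Longrightarrow> elements_mat (W \<omega>) \<subseteq> {0, 1}"
  using model by (simp_all add: stochastic_block_model_def)

lemma w_sym: "\<omega> \<in> space M \<Longrightarrow> i < 2 * n \<Longrightarrow> j < 2 * n \<Longrightarrow> w i j \<omega> = w j i \<omega>"
  using W_carrier W_transpose by (metis carrier_matD index_transpose_mat(1))

lemma w_01: "\<omega> \<in> space M \<Longrightarrow> i < 2 * n \<Longrightarrow> j < 2 * n \<Longrightarrow> w i j \<omega> \<in> {0, 1}"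
  using W_elements[of \<omega>] elements_matI[OF W_carrier, of \<omega> i j] by blast

lemma indep: "indep_vars (\<lambda>_. borel) (\<lambda>(i, j) \<omega>. w i j \<omega>) {(i, j). i \<le> j \<and> j < 2 * n}"
  using model by (simp add: stochastic_block_model_def)

lemma w_measurable: "i < 2 * n \<Longrightarrow> j < 2 * n \<Longrightarrow> w i j \<in> borel_measurable M"
proof -
  have *: "w i j \<in> borel_measurable M" if "i \<le> j" "j < 2 * n" for i j
    using indep that unfolding indep_vars_def by fastforce
  assume ij: "i < 2 * n" "j < 2 * n"
  show ?thesis
  proof (cases "i \<le> j")
    case False
    then have "w j i \<in> borel_measurable M" using * ij by simp
    moreover have "w i j \<in> borel_measurable M \<longleftrightarrow> w j i \<in> borel_measurable M"
      using w_sym ij by (intro measurable_cong) simp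
    ultimately show ?thesis by simp
  qed (use * ij in simp)
qed

text \<open>An ordered pair, a community and the other one, so that every estimate is proved once
  and used for both communities.\<close>

definition is_block :: "nat set \<Rightarrow> nat set \<Rightarrow> bool" where
  "is_block C C' \<longleftrightarrow> C = \<Gamma> 1 \<and> C' = \<Gamma> 2 \<or> C = \<Gamma> 2 \<and> C' = \<Gamma> 1"

lemma is_blockD:
  assumes "is_block C C'"
  shows "C \<subseteq> {..<2 * n}" "C' \<subseteq> {..<2 * n}" "C \<inter> C' = {}" "finite C" "finite C'" "card C = n" "card C' = n"
proof -
  show s: "C \<subseteq> {..<2 * n}" "C' \<subseteq> {..<2 * n}" using assms communities_simps(1) by (auto simp: is_block_def)
  show "finite C" "finite C'" using finite_subset[OF s(1)] finite_subset[OF s(2)] by simp_all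
  show "C \<inter> C' = {}" "card C = n" "card C' = n"
    using assms communities_simps by (auto simp: is_block_def)
qed

lemma prob_edge:
  assumes "is_block C C'" "i \<in> C"
  shows "j \<in> C \<Longrightarrow> prob {\<omega> \<in> space M. w i j \<omega> = 1} = p"
    and "j \<in> C' \<Longrightarrow> prob {\<omega> \<in> space M. w i j \<omega> = 1} = q"
proof -
  have e: "prob {\<omega> \<in> space M. w i j \<omega> = 1} = (if \<exists>a\<in>{1, 2}. i \<in> \<Gamma> a \<and> j \<in> \<Gamma> a then p else q)"
    if "i < 2 * n" "j < 2 * n" for i j
    using model that by (simp add: stochastic_block_model_def)
  have i: "i < 2 * n" using assms is_blockD by auto
  show "prob {\<omega> \<in> space M. w i j \<omega> = 1} = p" if "j \<in> C"
  proof -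
    have "\<exists>a\<in>{1, 2}. i \<in> \<Gamma> a \<and> j \<in> \<Gamma> a" using assms that by (auto simp: is_block_def)
    moreover have "j < 2 * n" using is_blockD(1)[OF assms(1)] that by auto
    ultimately show ?thesis using e[OF i] by simp
  qed
  show "prob {\<omega> \<in> space M. w i j \<omega> = 1} = q" if "j \<in> C'"
  proof -
    have "\<not> (\<exists>a\<in>{1, 2}. i \<in> \<Gamma> a \<and> j \<in> \<Gamma> a)"
      using assms that communities_simps(2) by (auto simp: is_block_def)
    moreover have "j < 2 * n" using is_blockD(2)[OF assms(1)] that by auto
    ultimately show ?thesis unfolding e[OF i \<open>j < 2 * n\<close>] by (intro if_not_P)
  qed
qed

lemma is_block_12: "is_block (\<Gamma> 1) (\<Gamma> 2)" "is_block (\<Gamma> 2) (\<Gamma> 1)"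
  by (simp_all add: is_block_def)

lemma p_bounds: "0 \<le> p" "p \<le> 1"
proof -
  have "\<Gamma> 1 \<noteq> {}" using communities_simps(3) n by auto
  then obtain i where i: "i \<in> \<Gamma> 1" by blast
  have "prob {\<omega> \<in> space M. w i i \<omega> = 1} = p" by (rule prob_edge(1)[OF is_block_12(1) i i])
  then show "0 \<le> p" "p \<le> 1" by (metis measure_nonneg, metis prob_le_1)
qed

section \<open>Tail bounds for degrees and for edge counts between sets\<close>

lemma w_sum_measurable: "i < 2 * n \<Longrightarrow> J \<subseteq> {..<2 * n} \<Longrightarrow> (\<lambda>\<omega>. \<Sum>j\<in>J. w i j \<omega>) \<in> borel_measurable M"
  by (intro borel_measurable_sum w_measurable) auto

text \<open>Independence is given for index pairs with i <= j, so the entries of a row are reindexed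
  by their sorted pairs.\<close>

lemma degree_chernoff:
  fixes \<rho> \<theta> u :: real
  assumes i: "i < 2 * n" and J: "J \<subseteq> {..<2 * n}" "i \<notin> J"
    and \<rho>: "\<And>j. j \<in> J \<Longrightarrow> prob {\<omega> \<in> space M. w i j \<omega> = 1} = \<rho>"
  shows "prob {\<omega> \<in> space M. \<theta> * u \<le> \<theta> * (\<Sum>j\<in>J. w i j \<omega>)} \<le> exp (- \<theta> * u + card J * \<rho> * (exp \<theta> - 1))"
proof -
  define f where "f = (\<lambda>j. (min i j, max i j))"
  define X where "X = (\<lambda>(i, j) \<omega>. w i j \<omega>)"
  have fin: "finite J" using J(1) finite_subset by auto
  have inj: "inj_on f J" unfolding f_def inj_on_def by (auto simp: min_def max_def split: if_splits)
  have Xf: "X (f j) \<omega> = w i j \<omega>" if "j \<in> J" "\<omega> \<in> space M" for j \<omega>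
    using w_sym[OF that(2) i, of j] that J by (auto simp: X_def f_def min_def max_def)
  have "prob {\<omega> \<in> space M. \<theta> * u \<le> \<theta> * (\<Sum>e\<in>f ` J. X e \<omega>)} \<le> exp (- \<theta> * u + card (f ` J) * \<rho> * (exp \<theta> - 1))"
  proof (rule chernoff_bernoulli_sum)
    have "f ` J \<subseteq> {(i, j). i \<le> j \<and> j < 2 * n}" using i J by (auto simp: f_def)
    then show "indep_vars (\<lambda>_. borel) X (f ` J)" unfolding X_def by (rule indep_vars_subset[OF indep])
    show "finite (f ` J)" using fin by simp
    show "X e \<omega> \<in> {0, 1}" if "e \<in> f ` J" "\<omega> \<in> space M" for e \<omega>
    proof -
      obtain j where j: "j \<in> J" "e = f j" using \<open>e \<in> f ` J\<close> by auto
      have "w i j \<omega> \<in> {0, 1}" using j J(1) i that(2) by (intro w_01) auto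
      then show ?thesis using Xf[OF j(1) that(2)] j(2) by simp
    qed
    show "prob {\<omega> \<in> space M. X e \<omega> = 1} = \<rho>" if e: "e \<in> f ` J" for e
    proof -
      obtain j where j: "j \<in> J" "e = f j" using e by auto
      have "{\<omega> \<in> space M. X e \<omega> = 1} = {\<omega> \<in> space M. w i j \<omega> = 1}" using Xf[OF j(1)] j(2) by auto
      then show ?thesis using \<rho>[OF j(1)] by simp
    qed
  qed
  moreover have "(\<Sum>e\<in>f ` J. X e \<omega>) = (\<Sum>j\<in>J. w i j \<omega>)" if "\<omega> \<in> space M" for \<omega>
    using inj Xf[OF _ that] by (simp add: sum.reindex)
  then have "{\<omega> \<in> space M. \<theta> * u \<le> \<theta> * (\<Sum>e\<in>f ` J. X e \<omega>)} = {\<omega> \<in> space M. \<theta> * u \<le> \<theta> * (\<Sum>j\<in>J. w i j \<omega>)}"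
    by auto
  ultimately show ?thesis using inj by (simp add: card_image)
qed

text \<open>Chernoff with \<theta> = -1: exp (-1) <= 2/5 gives the rate 2/5 - 3/5 = -1/5. The
  additive 3/5 pays for having n - 1 rather than \<open>n\<close> neighbours.\<close>

lemma inner_degree_lower_tail:
  assumes C: "is_block C C'" and i: "i \<in> C"
  shows "prob {\<omega> \<in> space M. (\<Sum>j\<in>C - {i}. w i j \<omega>) \<le> 2 / 5 * (n * p)} \<le> exp (3 / 5 - n * p / 5)"
proof -
  note C' = is_blockD[OF C]
  have card: "card (C - {i}) = n - 1" using C' i by simp
  have "prob {\<omega> \<in> space M. (-1) * (2 / 5 * (n * p)) \<le> (-1) * (\<Sum>j\<in>C - {i}. w i j \<omega>)}
      \<le> exp (- (-1) * (2 / 5 * (n * p)) + card (C - {i}) * p * (exp (-1) - 1))"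
  proof (rule degree_chernoff)
    show "prob {\<omega> \<in> space M. w i j \<omega> = 1} = p" if "j \<in> C - {i}" for j
      using prob_edge(1)[OF C i] that by simp
  qed (use C' i in auto)
  also have "\<dots> \<le> exp (3 / 5 - n * p / 5)"
  proof -
    have "exp (-1 :: real) \<le> 2 / 5"
    proof -
      have "5 / 2 \<le> exp (1 :: real)" using exp_lower_Taylor_quadratic[of 1] by simp
      then show ?thesis by (simp add: exp_minus field_simps)
    qed
    then have "card (C - {i}) * p * (exp (-1) - 1) \<le> card (C - {i}) * p * (- 3 / 5)"
      using p_bounds by (intro mult_left_mono) auto
    also have "\<dots> = - 3 / 5 * (n * p) + 3 / 5 * p"
      using n by (simp add: card of_nat_diff field_simps)
    finally show ?thesis using p_bounds by simp
  qed
  finally show ?thesis by simp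
qed

text \<open>Chernoff with \<theta> = 1: e - 1 <= 9/5 gives the rate 9/5 - 2 = -1/5.\<close>

lemma inner_degree_upper_tail:
  assumes C: "is_block C C'" and i: "i \<in> C"
  shows "prob {\<omega> \<in> space M. 2 * (n * p) \<le> (\<Sum>j\<in>C - {i}. w i j \<omega>)} \<le> exp (- (n * p) / 5)"
proof -
  note C' = is_blockD[OF C]
  have card: "card (C - {i}) \<le> n" using C' i by simp
  have "prob {\<omega> \<in> space M. 1 * (2 * (n * p)) \<le> 1 * (\<Sum>j\<in>C - {i}. w i j \<omega>)}
      \<le> exp (- 1 * (2 * (n * p)) + card (C - {i}) * p * (exp 1 - 1))"
  proof (rule degree_chernoff)
    show "prob {\<omega> \<in> space M. w i j \<omega> = 1} = p" if "j \<in> C - {i}" for j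
      using prob_edge(1)[OF C i] that by simp
  qed (use C' i in auto)
  also have "\<dots> \<le> exp (- (n * p) / 5)"
  proof -
    have "card (C - {i}) * p * (exp 1 - 1) \<le> n * p * (9 / 5)"
      using p_bounds card e_less_272 by (intro mult_mono) auto
    then show ?thesis by simp
  qed
  finally show ?thesis by simp
qed

lemma outer_degree_tail:
  assumes C: "is_block C C'" and i: "i \<in> C" and \<theta>: "\<theta> > 0"
  shows "prob {\<omega> \<in> space M. T \<le> (\<Sum>j\<in>C'. w i j \<omega>)} \<le> exp (n * q * (exp \<theta> - 1) - \<theta> * T)"
proof -
  note C' = is_blockD[OF C]
  have "prob {\<omega> \<in> space M. \<theta> * T \<le> \<theta> * (\<Sum>j\<in>C'. w i j \<omega>)}
      \<le> exp (- \<theta> * T + card C' * q * (exp \<theta> - 1))"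
  proof (rule degree_chernoff)
    show "prob {\<omega> \<in> space M. w i j \<omega> = 1} = q" if "j \<in> C'" for j
      using prob_edge(2)[OF C i] that by simp
  qed (use C' i in auto)
  then show ?thesis using \<theta> C' by simp
qed

text \<open>The right-hand side is shaped for the union bound: the inverse binomials sum to n + 1
  over each of the two sets, so the cube leaves a bound of order 1/n.\<close>

lemma discrepancy_tail:
  fixes \<epsilon> \<kappa> :: real
  assumes C: "is_block C C'" and ST: "S \<subseteq> C" "T \<subseteq> C" "S \<noteq> {}" "T \<noteq> {}"
    and bal: "card S \<le> \<kappa>\<^sup>2 * card T" "card T \<le> \<kappa>\<^sup>2 * card S"
    and \<epsilon>: "0 < \<epsilon>" "\<epsilon> \<le> 1" and \<kappa>: "1 \<le> \<kappa>"
    and large: "2 * (\<kappa> * (3 + 2 * ln \<kappa>)) + 3 \<le> \<epsilon>\<^sup>2 / 4 * (n * p)"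
  shows "prob {\<omega> \<in> space M. \<epsilon> * (n * p) * sqrt (card S * card T) \<le>
      \<bar>\<Sum>i\<in>S. \<Sum>j\<in>T. if i < j then w i j \<omega> - p else 0\<bar>}
    \<le> 2 / (1 + real n) ^ 3 * (1 / (n choose card S)) * (1 / (n choose card T))"
proof -
  note C' = is_blockD[OF C]
  have fin: "finite S" "finite T" using ST C'(4) by (auto intro: finite_subset)
  define s t \<sigma> where "s = card S" and "t = card T" and "\<sigma> = sqrt (card S * card T)"
  have st: "1 \<le> s" "1 \<le> t" "s \<le> n" "t \<le> n"
    using ST fin C' card_mono[of C S] card_mono[of C T] by (auto simp: s_def t_def Suc_le_eq card_gt_0_iff)
  have \<sigma>2: "\<sigma>\<^sup>2 = real s * real t" by (simp add: \<sigma>_def s_def t_def)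
  have \<sigma>0: "\<sigma> \<ge> 0" by (simp add: \<sigma>_def)
  have \<sigma>1: "1 \<le> \<sigma>"
  proof -
    have "1 * 1 \<le> real s * real t" using st by (intro mult_mono) auto
    then show ?thesis by (simp add: \<sigma>_def s_def t_def)
  qed
  have \<sigma>n: "\<sigma> \<le> n"
  proof (rule power2_le_imp_le)
    have "real s * real t \<le> real n * real n" using st by (intro mult_mono) auto
    then show "\<sigma>\<^sup>2 \<le> (real n)\<^sup>2" unfolding \<sigma>2 by (simp add: power2_eq_square)
  qed simp
  have le_\<sigma>: "a \<le> \<kappa> * \<sigma>" "\<sigma> \<le> \<kappa> * b" if "a * a \<le> \<kappa>\<^sup>2 * (real s * real t)" "real s * real t \<le> \<kappa>\<^sup>2 * (b * b)" "b \<ge> 0"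
    for a b :: real
  proof -
    show "a \<le> \<kappa> * \<sigma>"
    proof (rule power2_le_imp_le)
      show "a\<^sup>2 \<le> (\<kappa> * \<sigma>)\<^sup>2" unfolding power_mult_distrib \<sigma>2 using that(1) by (simp add: power2_eq_square)
    qed (use \<kappa> \<sigma>0 in simp)
    show "\<sigma> \<le> \<kappa> * b"
    proof (rule power2_le_imp_le)
      show "\<sigma>\<^sup>2 \<le> (\<kappa> * b)\<^sup>2" unfolding power_mult_distrib \<sigma>2 using that(2) by (simp add: power2_eq_square)
    qed (use \<kappa> that(3) in simp)
  qed
  have bal': "real s \<le> \<kappa>\<^sup>2 * real t" "real t \<le> \<kappa>\<^sup>2 * real s" using bal by (auto simp: s_def t_def)
  have m: "real s * real s \<le> \<kappa>\<^sup>2 * (real s * real t)" "real t * real t \<le> \<kappa>\<^sup>2 * (real s * real t)"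
    "real s * real t \<le> \<kappa>\<^sup>2 * (real s * real s)" "real s * real t \<le> \<kappa>\<^sup>2 * (real t * real t)"
    using mult_left_mono[OF bal'(1), of "real s"] mult_left_mono[OF bal'(2), of "real t"]
      mult_left_mono[OF bal'(2), of "real s"] mult_left_mono[OF bal'(1), of "real t"]
    by (simp_all add: mult_ac)
  define K where "K = \<kappa> * (3 + 2 * ln \<kappa>)"
  define L where "L = \<sigma> * ln (1 + n / \<sigma>)"
  have binS: "real (n choose s) \<le> exp (K * L)" unfolding K_def L_def
    by (rule binomial_le_exp_scaled)
      (use st \<kappa> \<sigma>1 \<sigma>n le_\<sigma>[OF m(1) m(3) of_nat_0_le_iff] in auto)
  have binT: "real (n choose t) \<le> exp (K * L)" unfolding K_def L_def
    by (rule binomial_le_exp_scaled)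
      (use st \<kappa> \<sigma>1 \<sigma>n le_\<sigma>[OF m(2) m(4) of_nat_0_le_iff] in auto)
  \<comment> \<open>By \<sigma> >= 1 and concavity, \<open>L\<close> is at least its value at
    \<sigma> = 1, so even the smallest sets have an exponent of order log n.\<close>
  have Lge: "ln (1 + real n) \<le> L"
  proof -
    have "1 / \<sigma> * ln (1 + real n) \<le> ln (1 + 1 / \<sigma> * n)" using \<sigma>1 by (intro ln_one_plus_scaled_ge) auto
    then show ?thesis using \<sigma>1 by (simp add: L_def field_simps)
  qed
  have L0: "0 \<le> L" using Lge by (rule order_trans[rotated]) simp
  define E where "E = {(i, j). i \<in> S \<and> j \<in> T \<and> i < j}"
  define X where "X = (\<lambda>(i, j) \<omega>. w i j \<omega>)"
  have E: "E \<subseteq> S \<times> T" by (auto simp: E_def)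
  have finE: "finite E" using finite_subset[OF E] fin by simp
  have cardE: "card E \<le> s * t" using card_mono[OF _ E] fin by (simp add: s_def t_def)
  have sumE: "(\<Sum>i\<in>S. \<Sum>j\<in>T. if i < j then w i j \<omega> - p else 0) = (\<Sum>e\<in>E. X e \<omega> - p)" for \<omega>
  proof -
    have "(\<Sum>i\<in>S. \<Sum>j\<in>T. if i < j then w i j \<omega> - p else 0)
      = (\<Sum>e\<in>S \<times> T. if fst e < snd e then X e \<omega> - p else 0)"
      unfolding sum.cartesian_product by (intro sum.cong) (auto simp: X_def)
    also have "\<dots> = (\<Sum>e\<in>E. X e \<omega> - p)"
      using fin E by (intro sum.mono_neutral_cong_right) (auto simp: E_def)
    finally show ?thesis .
  qed
  have sub: "i < 2 * n" if "i \<in> S \<or> i \<in> T" for i using that ST C' by auto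
  define \<theta> where "\<theta> = ln (1 + \<epsilon> / 2 * (n / \<sigma>))"
  have \<theta>: "\<theta> > 0" unfolding \<theta>_def using \<epsilon> n \<sigma>1 by (intro ln_gt_zero) simp
  have "prob {\<omega> \<in> space M. \<epsilon> * (n * p) * \<sigma> \<le> \<bar>\<Sum>e\<in>E. X e \<omega> - p\<bar>}
     \<le> 2 * exp (- \<theta> * (\<epsilon> * (n * p) * \<sigma>) + (s * t) * p * (exp \<theta> - 1 - \<theta>))"
  proof (rule chernoff_bernoulli_deviation)
    have "E \<subseteq> {(i, j). i \<le> j \<and> j < 2 * n}" using sub by (auto simp: E_def)
    then show "indep_vars (\<lambda>_. borel) X E" unfolding X_def by (rule indep_vars_subset[OF indep])
    show "X e \<omega> \<in> {0, 1}" if e\<omega>: "e \<in> E" "\<omega> \<in> space M" for e \<omega>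
    proof -
      obtain i j where e: "e = (i, j)" by (cases e)
      then have "i < 2 * n" "j < 2 * n" using e\<omega>(1) sub by (auto simp: E_def)
      then show ?thesis using w_01[OF e\<omega>(2)] by (simp add: e X_def)
    qed
    show "prob {\<omega> \<in> space M. X e \<omega> = 1} = p" if "e \<in> E" for e
    proof -
      obtain i j where e: "e = (i, j)" by (cases e)
      then have "i \<in> C" "j \<in> C" using that ST by (auto simp: E_def)
      then show ?thesis using prob_edge(1)[OF C] by (simp add: e X_def)
    qed
  qed (use finE \<theta> p_bounds cardE in auto)
  also have "- \<theta> * (\<epsilon> * (n * p) * \<sigma>) + (s * t) * p * (exp \<theta> - 1 - \<theta>)
      = - \<theta> * (\<epsilon> * (n * p) * \<sigma>) + (n * p) * \<sigma>\<^sup>2 / n * (exp \<theta> - 1 - \<theta>)"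
    using n by (simp add: \<sigma>2)
  also have "\<dots> \<le> - (\<epsilon>\<^sup>2 / 4) * (n * p) * (\<sigma> * ln (1 + n / \<sigma>))"
    unfolding \<theta>_def using \<epsilon> p_bounds n \<sigma>1 by (intro chernoff_exponent_bound) auto
  \<comment> \<open>The exponent is spent as \<open>K * L\<close> for each of the two binomials and
    \<open>3 * L\<close> for the power (1 + n)^3.\<close>
  also have "\<dots> \<le> - ((2 * K + 3) * L)"
    using mult_right_mono[OF large L0] by (simp add: K_def L_def)
  also have "2 * exp (- ((2 * K + 3) * L)) = 2 * exp (- (3 * L)) * (exp (- (K * L)) * exp (- (K * L)))"
    by (simp add: exp_add[symmetric] algebra_simps)
  also have "\<dots> \<le> 2 * (1 / (1 + real n) ^ 3) * ((1 / (n choose s)) * (1 / (n choose t)))"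
  proof -
    have inv: "exp (- (K * L)) \<le> 1 / b" if "b \<le> exp (K * L)" "b > 0" for b
      using that by (simp add: exp_minus field_simps)
    have "exp (- (K * L)) \<le> 1 / (n choose s)" "exp (- (K * L)) \<le> 1 / (n choose t)"
      using binS binT st by (auto intro!: inv)
    moreover have "exp (- (3 * L)) \<le> 1 / (1 + real n) ^ 3"
    proof -
      have "exp (- (3 * L)) \<le> exp (- (3 * ln (1 + real n)))" using Lge by simp
      also have "\<dots> = 1 / (1 + real n) ^ 3"
        using exp_of_nat_mult[of 3 "ln (1 + real n)"] by (simp add: exp_minus field_simps)
      finally show ?thesis .
    qed
    ultimately show ?thesis by (intro mult_mono) auto
  qed
  finally show ?thesis unfolding sumE \<sigma>_def s_def t_def by (simp add: mult_ac)
qed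

text \<open>Recovery quantifies over uncountably many \<open>Z\<close>, but \<open>W\<close> takes
  finitely many values, so the event is a finite union of events fixing all entries.\<close>

lemma recovery_event_measurable:
  "{\<omega> \<in> space M. rcut_recovers (2 * n) 2 (W \<omega>) \<Gamma>} \<in> events"
proof -
  define N where "N = 2 * n"
  define A where "A = (\<lambda>F. mat N N (\<lambda>e. if e \<in> F then 1 else 0 :: real))"
  define \<F> where "\<F> = {F \<in> Pow ({..<N} \<times> {..<N}). rcut_recovers N 2 (A F) \<Gamma>}"
  have "\<F> \<subseteq> Pow ({..<N} \<times> {..<N})" by (auto simp: \<F>_def)
  then have fin: "finite \<F>" by (rule finite_subset) simp
  have W_A: "W \<omega> = A {e \<in> {..<N} \<times> {..<N}. W \<omega> $$ e = 1}" if "\<omega> \<in> space M" for \<omega>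
  proof (rule eq_matI)
    fix i j assume ij: "i < dim_row (A {e \<in> {..<N} \<times> {..<N}. W \<omega> $$ e = 1})"
      "j < dim_col (A {e \<in> {..<N} \<times> {..<N}. W \<omega> $$ e = 1})"
    then have "i < N" "j < N" by (simp_all add: A_def)
    moreover from this have "w i j \<omega> \<in> {0, 1}" using w_01[OF that] by (simp add: N_def)
    ultimately show "w i j \<omega> = A {e \<in> {..<N} \<times> {..<N}. W \<omega> $$ e = 1} $$ (i, j)" by (auto simp: A_def)
  qed (use W_carrier[OF that] in \<open>auto simp: A_def N_def\<close>)
  have "{\<omega> \<in> space M. rcut_recovers N 2 (W \<omega>) \<Gamma>}
      = (\<Union>F\<in>\<F>. {\<omega> \<in> space M. \<forall>e\<in>{..<N} \<times> {..<N}. W \<omega> $$ e = A F $$ e})" (is "?L = ?R")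
  proof (intro equalityI subsetI)
    fix \<omega> assume "\<omega> \<in> ?L"
    then have \<omega>: "\<omega> \<in> space M" "rcut_recovers N 2 (W \<omega>) \<Gamma>" by auto
    let ?F = "{e \<in> {..<N} \<times> {..<N}. W \<omega> $$ e = 1}"
    have "?F \<in> \<F>" unfolding \<F>_def using \<omega>(2) W_A[OF \<omega>(1)] by simp
    moreover have "\<forall>e\<in>{..<N} \<times> {..<N}. W \<omega> $$ e = A ?F $$ e" using W_A[OF \<omega>(1)] by simp
    ultimately show "\<omega> \<in> ?R" using \<omega>(1) by blast
  next
    fix \<omega> assume "\<omega> \<in> ?R"
    then obtain F where F: "F \<in> \<F>" "\<omega> \<in> space M" "\<forall>e\<in>{..<N} \<times> {..<N}. W \<omega> $$ e = A F $$ e" by blast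
    have "W \<omega> = A F"
      by (rule eq_matI) (use F W_carrier[OF F(2)] in \<open>auto simp: A_def N_def\<close>)
    then show "\<omega> \<in> ?L" using F by (auto simp: \<F>_def)
  qed
  also have "\<dots> \<in> events"
  proof (intro sets.finite_UN fin)
    fix F
    have "{\<omega> \<in> space M. W \<omega> $$ e = A F $$ e} \<in> events" if "e \<in> {..<N} \<times> {..<N}" for e
    proof -
      obtain i j where e: "e = (i, j)" by (cases e)
      have [measurable]: "w i j \<in> borel_measurable M" using that e by (intro w_measurable) (auto simp: N_def)
      show ?thesis unfolding e by measurable
    qed
    then show "{\<omega> \<in> space M. \<forall>e\<in>{..<N} \<times> {..<N}. W \<omega> $$ e = A F $$ e} \<in> events"
      by (intro sets.sets_Collect_finite_All) auto
  qed
  finally show ?thesis by (simp add: N_def)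
qed

text \<open>In the last union \<open>T\<close> is a set bound by the pair and shadows the real
  threshold \<open>T\<close> of the third one.\<close>

definition block_failure :: "real \<Rightarrow> nat set \<Rightarrow> nat set \<Rightarrow> 'a set" where
  "block_failure T C C' =
     (\<Union>i\<in>C. {\<omega> \<in> space M. (\<Sum>j\<in>C - {i}. w i j \<omega>) \<le> 2 / 5 * (n * p)}) \<union>
     (\<Union>i\<in>C. {\<omega> \<in> space M. 2 * (n * p) \<le> (\<Sum>j\<in>C - {i}. w i j \<omega>)}) \<union>
     (\<Union>i\<in>C. {\<omega> \<in> space M. T \<le> (\<Sum>j\<in>C'. w i j \<omega>)}) \<union>
     (\<Union>(S, T)\<in>{(S, T). S \<subseteq> C \<and> T \<subseteq> C \<and> S \<noteq> {} \<and> T \<noteq> {} \<and>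
         card S \<le> 30000\<^sup>2 * real (card T) \<and> card T \<le> 30000\<^sup>2 * real (card S)}.
       {\<omega> \<in> space M. 1 / 10000 * (n * p) * sqrt (card S * card T) \<le>
         \<bar>\<Sum>i\<in>S. \<Sum>j\<in>T. if i < j then w i j \<omega> - p else 0\<bar>})"

lemma prob_block_failure:
  assumes C: "is_block C C'" and \<theta>: "\<theta> > 0"
    and large: "2 * (30000 * (3 + 2 * ln 30000)) + 3 \<le> (1 / 10000)\<^sup>2 / 4 * (n * p)"
  shows "block_failure T C C' \<in> events"
    and "prob (block_failure T C C') \<le> n * exp (3 / 5 - n * p / 5) + n * exp (- (n * p) / 5)
      + n * exp (n * q * (exp \<theta> - 1) - \<theta> * T) + 2 / (1 + real n)"
proof -
  note C' = is_blockD[OF C]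
  define B1 B2 B3 where "B1 = (\<lambda>i. {\<omega> \<in> space M. (\<Sum>j\<in>C - {i}. w i j \<omega>) \<le> 2 / 5 * (n * p)})"
    and "B2 = (\<lambda>i. {\<omega> \<in> space M. 2 * (n * p) \<le> (\<Sum>j\<in>C - {i}. w i j \<omega>)})"
    and "B3 = (\<lambda>i. {\<omega> \<in> space M. T \<le> (\<Sum>j\<in>C'. w i j \<omega>)})"
  define \<P> where "\<P> = {(S, T). S \<subseteq> C \<and> T \<subseteq> C \<and> S \<noteq> {} \<and> T \<noteq> {} \<and>
         card S \<le> 30000\<^sup>2 * real (card T) \<and> card T \<le> 30000\<^sup>2 * real (card S)}"
  define B4 where "B4 = (\<lambda>(S, T). {\<omega> \<in> space M. 1 / 10000 * (n * p) * sqrt (card S * card T) \<le>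
         \<bar>\<Sum>i\<in>S. \<Sum>j\<in>T. if i < j then w i j \<omega> - p else 0\<bar>})"
  have eq: "block_failure T C C' = (\<Union>i\<in>C. B1 i) \<union> (\<Union>i\<in>C. B2 i) \<union> (\<Union>i\<in>C. B3 i) \<union> (\<Union>P\<in>\<P>. B4 P)"
    unfolding block_failure_def B1_def B2_def B3_def B4_def \<P>_def ..
  have \<P>: "\<P> \<subseteq> Pow C \<times> Pow C" "finite \<P>"
  proof -
    show "\<P> \<subseteq> Pow C \<times> Pow C" by (auto simp: \<P>_def)
    then show "finite \<P>" by (rule finite_subset) (use C' in simp)
  qed
  have ev: "B1 i \<in> events" "B2 i \<in> events" "B3 i \<in> events" if "i \<in> C" for i
  proof -
    have "i < 2 * n" "C - {i} \<subseteq> {..<2 * n}" using that C' by auto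
    then have [measurable]: "(\<lambda>\<omega>. \<Sum>j\<in>C - {i}. w i j \<omega>) \<in> borel_measurable M"
      "(\<lambda>\<omega>. \<Sum>j\<in>C'. w i j \<omega>) \<in> borel_measurable M"
      using C' by (intro w_sum_measurable; simp)+
    show "B1 i \<in> events" "B2 i \<in> events" "B3 i \<in> events" unfolding B1_def B2_def B3_def by measurable
  qed
  have ev4: "B4 P \<in> events" if "P \<in> \<P>" for P
  proof -
    obtain S T where P: "P = (S, T)" by (cases P)
    have sub: "S \<subseteq> {..<2 * n}" "T \<subseteq> {..<2 * n}" using that C' by (auto simp: P \<P>_def)
    have [measurable]: "(\<lambda>\<omega>. \<Sum>i\<in>S. \<Sum>j\<in>T. if i < j then w i j \<omega> - p else 0) \<in> borel_measurable M"
    proof (intro borel_measurable_sum)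
      fix i j assume "i \<in> S" "j \<in> T"
      then have [measurable]: "w i j \<in> borel_measurable M" using sub by (intro w_measurable) auto
      show "(\<lambda>\<omega>. if i < j then w i j \<omega> - p else 0) \<in> borel_measurable M" by measurable
    qed
    show ?thesis unfolding P B4_def by simp
  qed
  have evU: "(\<Union>i\<in>C. B1 i) \<in> events" "(\<Union>i\<in>C. B2 i) \<in> events" "(\<Union>i\<in>C. B3 i) \<in> events"
    "(\<Union>P\<in>\<P>. B4 P) \<in> events"
    using ev ev4 C' \<P> by (auto intro!: sets.finite_UN)
  then show "block_failure T C C' \<in> events" unfolding eq by (intro sets.Un)
  have p1: "prob (\<Union>i\<in>C. B1 i) \<le> card C * exp (3 / 5 - n * p / 5)"
    by (rule prob_Union_le) (use C' ev inner_degree_lower_tail[OF C] in \<open>auto simp: B1_def\<close>)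
  have p2: "prob (\<Union>i\<in>C. B2 i) \<le> card C * exp (- (n * p) / 5)"
    by (rule prob_Union_le) (use C' ev inner_degree_upper_tail[OF C] in \<open>auto simp: B2_def\<close>)
  have p3: "prob (\<Union>i\<in>C. B3 i) \<le> card C * exp (n * q * (exp \<theta> - 1) - \<theta> * T)"
    by (rule prob_Union_le) (use C' ev outer_degree_tail[OF C _ \<theta>] in \<open>auto simp: B3_def\<close>)
  have p4: "prob (\<Union>P\<in>\<P>. B4 P) \<le> 2 / (1 + real n)"
  proof -
    have "prob (\<Union>P\<in>\<P>. B4 P) \<le> (\<Sum>P\<in>\<P>. prob (B4 P))"
      using \<P> ev4 by (intro measure_UNION_le) auto
    also have "\<dots> \<le> (\<Sum>(S, T)\<in>\<P>. 2 / (1 + real n) ^ 3 * (1 / (n choose card S)) * (1 / (n choose card T)))"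
    proof (intro sum_mono)
      fix P assume P: "P \<in> \<P>"
      obtain S T where ST: "P = (S, T)" by (cases P)
      have "prob (B4 (S, T)) \<le> 2 / (1 + real n) ^ 3 * (1 / (n choose card S)) * (1 / (n choose card T))"
        unfolding B4_def prod.case
        by (rule discrepancy_tail[OF C, where \<kappa> = 30000]) (use P large in \<open>auto simp: ST \<P>_def\<close>)
      then show "prob (B4 P) \<le> (case P of (S, T) \<Rightarrow>
          2 / (1 + real n) ^ 3 * (1 / (n choose card S)) * (1 / (n choose card T)))"
        by (simp add: ST)
    qed
    \<comment> \<open>Enlarging the index set to all pairs of subsets makes the sum factor into two
      sums of inverse binomials.\<close>
    also have "\<dots> \<le> (\<Sum>(S, T)\<in>Pow C \<times> Pow C. 2 / (1 + real n) ^ 3 * (1 / (n choose card S)) * (1 / (n choose card T)))"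
      using \<P> C' by (intro sum_mono2) auto
    also have "\<dots> = 2 / (1 + real n) ^ 3 * ((\<Sum>S\<in>Pow C. 1 / (n choose card S)) * (\<Sum>T\<in>Pow C. 1 / (n choose card T)))"
    proof -
      have "(\<Sum>(S, T)\<in>Pow C \<times> Pow C. c * f S * f T) = c * ((\<Sum>S\<in>Pow C. f S) * (\<Sum>T\<in>Pow C. f T))"
        for c and f :: "nat set \<Rightarrow> real"
        unfolding sum_product sum.cartesian_product by (simp add: sum_distrib_left split_def mult.assoc)
      then show ?thesis .
    qed
    also have "\<dots> = 2 / (1 + real n) ^ 3 * ((1 + real n) * (1 + real n))"
      using sum_Pow_inverse_binomial[OF C'(4)] C' by (simp add: add.commute)
    also have "\<dots> = 2 / (1 + real n)" by (simp add: power3_eq_cube)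
    finally show ?thesis .
  qed
  have "prob (block_failure T C C') \<le> prob (\<Union>i\<in>C. B1 i) + prob (\<Union>i\<in>C. B2 i) + prob (\<Union>i\<in>C. B3 i) + prob (\<Union>P\<in>\<P>. B4 P)"
    unfolding eq
    by (intro order_trans[OF measure_Un_le] add_mono measure_Un_le sets.Un evU order_refl)
  also have "\<dots> \<le> n * exp (3 / 5 - n * p / 5) + n * exp (- (n * p) / 5)
      + n * exp (n * q * (exp \<theta> - 1) - \<theta> * T) + 2 / (1 + real n)"
    using p1 p2 p3 p4 C' by (intro add_mono) simp_all
  finally show "prob (block_failure T C C') \<le> n * exp (3 / 5 - n * p / 5) + n * exp (- (n * p) / 5)
      + n * exp (n * q * (exp \<theta> - 1) - \<theta> * T) + 2 / (1 + real n)" .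
qed

text \<open>
  With discrepancy \<open>np / 10000\<close>, \<open>r = 8\<close> and degrees in \<open>[2/5 np, 2 np]\<close> the gap is at least
  \<open>0.32 np\<close>, and \<open>0.32 > 4/13\<close>, the ratio of \<open>4 (\<alpha>/26) log N\<close> to \<open>np = (\<alpha>/2) log N\<close>. Sets \<open>S\<close>, \<open>T\<close>
  whose sizes differ by a factor above \<open>30000\<^sup>2\<close> satisfy the discrepancy bound because row
  sums are at most \<open>3 np = 30000 (np / 10000)\<close>.
\<close>

lemma spectral_gap_off_failure:
  assumes C: "is_block C C'" and \<omega>: "\<omega> \<in> space M" "\<omega> \<notin> block_failure T C C'"
  shows "8 / 25 * (n * p) * ((\<Sum>i\<in>C. (x i)\<^sup>2) - (\<Sum>i\<in>C. x i)\<^sup>2 / n)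
     \<le> (\<Sum>i\<in>C. \<Sum>j\<in>C. w i j \<omega> * (x i - x j)\<^sup>2) / 2"
proof -
  note C' = is_blockD[OF C]
  define d where "d = n * p"
  have d0: "d \<ge> 0" using p_bounds by (simp add: d_def)
  have m: "i < 2 * n" if "i \<in> C" for i using that C' by auto
  have gap: "(2 / 5 * d - 2 * (16 * (2 * 8 + 1) * (1 / 10000 * d) + (2 * d + d) / 2 ^ 8))
      * ((\<Sum>i\<in>C. (x i)\<^sup>2) - (\<Sum>i\<in>C. x i)\<^sup>2 / n)
      \<le> (\<Sum>i\<in>C. \<Sum>j\<in>C. w i j \<omega> * (x i - x j)\<^sup>2) / 2"
  proof -
    have "(2 / 5 * d - 2 * (real (16 * (2 * 8 + 1)) * (1 / 10000 * d) + (2 * d + n * p) / 2 ^ 8))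
      * ((\<Sum>i\<in>C. (x i)\<^sup>2) - (\<Sum>i\<in>C. x i)\<^sup>2 / n)
      \<le> (\<Sum>i\<in>C. \<Sum>j\<in>C. w i j \<omega> * (x i - x j)\<^sup>2) / 2"
    proof (rule spectral_gap_of_discrepancy[where \<kappa> = 30000])
      show "w i j \<omega> = w j i \<omega>" if "i \<in> C" "j \<in> C" for i j using w_sym[OF \<omega>(1)] m that by simp
      show "0 \<le> w i j \<omega>" if "i \<in> C" "j \<in> C" for i j using w_01[OF \<omega>(1) m[OF that(1)] m[OF that(2)]] by auto
      show "2 / 5 * d \<le> (\<Sum>j\<in>C - {i}. w i j \<omega>)" if "i \<in> C" for i
        using \<omega> that by (auto simp: block_failure_def d_def)
      show "(\<Sum>j\<in>C - {i}. w i j \<omega>) \<le> 2 * d" if "i \<in> C" for i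
        using \<omega> that by (auto simp: block_failure_def d_def)
      show "\<forall>S T. S \<subseteq> C \<longrightarrow> T \<subseteq> C \<longrightarrow> S \<noteq> {} \<longrightarrow> T \<noteq> {} \<longrightarrow>
        card S \<le> 30000\<^sup>2 * real (card T) \<longrightarrow> card T \<le> 30000\<^sup>2 * real (card S) \<longrightarrow>
        \<bar>\<Sum>i\<in>S. \<Sum>j\<in>T. if i < j then w i j \<omega> - p else 0\<bar> \<le> 1 / 10000 * d * sqrt (card S * card T)"
      proof (intro allI impI)
        fix S T assume ST: "S \<subseteq> C" "T \<subseteq> C" "S \<noteq> {}" "T \<noteq> {}"
          "card S \<le> 30000\<^sup>2 * real (card T)" "card T \<le> 30000\<^sup>2 * real (card S)"
        have "\<not> 1 / 10000 * (n * p) * sqrt (card S * card T) \<le>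
          \<bar>\<Sum>i\<in>S. \<Sum>j\<in>T. if i < j then w i j \<omega> - p else 0\<bar>"
        proof
          assume "1 / 10000 * (n * p) * sqrt (card S * card T) \<le>
            \<bar>\<Sum>i\<in>S. \<Sum>j\<in>T. if i < j then w i j \<omega> - p else 0\<bar>"
          \<comment> \<open>Here \<open>T\<close> names the fixed set, so membership is shown for
            every threshold \<open>T'\<close>, which includes the outer one.\<close>
          then have "\<omega> \<in> block_failure T' C C'" for T'
            unfolding block_failure_def using ST \<omega>(1) by (intro UnI2 UN_I[of "(S, T)"]) auto
          then show False using \<omega>(2) by simp
        qed
        then show "\<bar>\<Sum>i\<in>S. \<Sum>j\<in>T. if i < j then w i j \<omega> - p else 0\<bar> \<le> 1 / 10000 * d * sqrt (card S * card T)"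
          by (simp add: d_def)
      qed
    qed (use C' n d0 p_bounds in \<open>auto simp: d_def\<close>)
    then show ?thesis unfolding d_def[symmetric] by simp
  qed
  \<comment> \<open>Numerically the right side is 0.4 - 2 (0.0272 + 3/256), about 0.322, times
    \<open>d\<close>.\<close>
  have "8 / 25 * d \<le> 2 / 5 * d - 2 * (16 * (2 * 8 + 1) * (1 / 10000 * d) + (2 * d + d) / 2 ^ 8)"
    using d0 by simp
  moreover have "0 \<le> (\<Sum>i\<in>C. (x i)\<^sup>2) - (\<Sum>i\<in>C. x i)\<^sup>2 / n"
  proof -
    have "(\<Sum>i\<in>C. x i * 1)\<^sup>2 \<le> (\<Sum>i\<in>C. (x i)\<^sup>2) * (\<Sum>i\<in>C. 1\<^sup>2)" by (rule Cauchy_Schwarz_ineq_sum)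
    then show ?thesis using C' n by (simp add: field_simps)
  qed
  ultimately show ?thesis
    unfolding d_def[symmetric] using gap by (meson mult_right_mono order_trans)
qed

text \<open>Off the failure events of both communities the deterministic criterion applies; the
  factor 2 counts the communities. The parameter \<theta> stays free until the Bernstein exponent is
  optimized.\<close>

lemma prob_recovery_lower_bound:
  assumes T: "4 * T < 8 / 25 * (n * p)" and \<theta>: "\<theta> > 0"
    and large: "2 * (30000 * (3 + 2 * ln 30000)) + 3 \<le> (1 / 10000)\<^sup>2 / 4 * (n * p)"
  shows "1 - 2 * (n * exp (3 / 5 - n * p / 5) + n * exp (- (n * p) / 5)
      + n * exp (n * q * (exp \<theta> - 1) - \<theta> * T) + 2 / (1 + real n))
    \<le> prob {\<omega> \<in> space M. rcut_recovers (2 * n) 2 (W \<omega>) \<Gamma>}"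
proof -
  let ?R = "{\<omega> \<in> space M. rcut_recovers (2 * n) 2 (W \<omega>) \<Gamma>}"
  let ?F = "block_failure T (\<Gamma> 1) (\<Gamma> 2) \<union> block_failure T (\<Gamma> 2) (\<Gamma> 1)"
  note ev = prob_block_failure(1)[OF is_block_12(1) \<theta> large, of T] prob_block_failure(1)[OF is_block_12(2) \<theta> large, of T]
  note pr = prob_block_failure(2)[OF is_block_12(1) \<theta> large, of T] prob_block_failure(2)[OF is_block_12(2) \<theta> large, of T]
  have recovers: "rcut_recovers (2 * n) 2 (W \<omega>) \<Gamma>" if \<omega>: "\<omega> \<in> space M" "\<omega> \<notin> ?F" for \<omega>
  proof (rule rcut_recovers_of_spectral_gap[OF n communities W_carrier[OF \<omega>(1)] W_transpose[OF \<omega>(1)]])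
    show "0 \<le> w i j \<omega>" if "i < 2 * n" "j < 2 * n" for i j using w_01[OF \<omega>(1) that] by auto
    show "8 / 25 * (n * p) * ((\<Sum>i\<in>C. (x i)\<^sup>2) - (\<Sum>i\<in>C. x i)\<^sup>2 / n)
        \<le> (\<Sum>i\<in>C. \<Sum>j\<in>C. w i j \<omega> * (x i - x j)\<^sup>2) / 2" if "C = \<Gamma> 1 \<or> C = \<Gamma> 2" for C x
      using that
    proof
      assume "C = \<Gamma> 1"
      then show ?thesis using spectral_gap_off_failure[OF is_block_12(1) \<omega>(1)] \<omega>(2) by blast
    next
      assume "C = \<Gamma> 2"
      then show ?thesis using spectral_gap_off_failure[OF is_block_12(2) \<omega>(1)] \<omega>(2) by blast
    qed
    have out: "(\<Sum>j\<in>C'. w i j \<omega>) \<le> T" if "\<omega> \<notin> block_failure T C C'" "i \<in> C" for i C C'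
      using that \<omega>(1) by (auto simp: block_failure_def)
    show "(\<Sum>j\<in>\<Gamma> 2. w i j \<omega>) \<le> T" if "i \<in> \<Gamma> 1" for i by (rule out[OF _ that]) (use \<omega> in simp)
    show "(\<Sum>j\<in>\<Gamma> 1. w i j \<omega>) \<le> T" if "i \<in> \<Gamma> 2" for i by (rule out[OF _ that]) (use \<omega> in simp)
    show "4 * T < 8 / 25 * (n * p)" by (rule T)
  qed
  have "prob (space M - ?R) \<le> prob ?F"
    using recovers ev by (intro finite_measure_mono sets.Un) auto
  also have "\<dots> \<le> prob (block_failure T (\<Gamma> 1) (\<Gamma> 2)) + prob (block_failure T (\<Gamma> 2) (\<Gamma> 1))"
    using ev by (rule measure_Un_le)
  finally have "1 - prob ?R \<le> prob (block_failure T (\<Gamma> 1) (\<Gamma> 2)) + prob (block_failure T (\<Gamma> 2) (\<Gamma> 1))"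
    using prob_compl[OF recovery_event_measurable] by simp
  also have "\<dots> \<le> 2 * (n * exp (3 / 5 - n * p / 5) + n * exp (- (n * p) / 5)
      + n * exp (n * q * (exp \<theta> - 1) - \<theta> * T) + 2 / (1 + real n))"
    unfolding mult_2 by (intro add_mono[OF pr])
  finally show ?thesis by simp
qed

end

section \<open>Bernstein's exponent and the limit\<close>

lemma prob_recovery_lower_bound_sbm:
  assumes "stochastic_block_model n \<Gamma> p q M W" "n > 0"
    and "4 * T < 8 / 25 * (n * p)" "\<theta> > 0"
    and "2 * (30000 * (3 + 2 * ln 30000)) + 3 \<le> (1 / 10000)\<^sup>2 / 4 * (n * p)"
  shows "1 - 2 * (n * exp (3 / 5 - n * p / 5) + n * exp (- (n * p) / 5)
      + n * exp (n * q * (exp \<theta> - 1) - \<theta> * T) + 2 / (1 + real n))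
    \<le> measure M {\<omega> \<in> space M. rcut_recovers (2 * n) 2 (W \<omega>) \<Gamma>}"
proof -
  have "sbm M n \<Gamma> p q W"
    using assms(1,2) by (simp add: sbm_def sbm_axioms_def stochastic_block_model_def)
  then show ?thesis using assms(3-) by (rule sbm.prob_recovery_lower_bound)
qed

text \<open>The exponent is measured per unit of log N. The union over vertices costs 1, so a rate g
  > 1 is required; strictness of the assumption on \<alpha> supplies it.\<close>

lemma bernstein_exponent:
  fixes \<alpha> \<beta> :: real
  assumes \<beta>: "\<beta> > 0" and \<alpha>: "\<alpha> > 26 * (1 / 3 + \<beta> / 2 + sqrt (1 / 9 + \<beta>))"
  obtains \<theta> g where "\<theta> > 0" "g > 1" "\<beta> / 2 * (exp \<theta> - 1) - \<theta> * (\<alpha> / 26) \<le> - g"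
proof -
  define x where "x = \<alpha> / 26 - \<beta> / 2"
  define b where "b = \<beta> / 2"
  have x: "x - 1 / 3 > sqrt (1 / 9 + \<beta>)" using \<alpha> by (simp add: x_def)
  moreover have "sqrt (1 / 9 + \<beta>) > 0" using \<beta> by simp
  ultimately have x0: "x > 0" by linarith
  have "(sqrt (1 / 9 + \<beta>))\<^sup>2 < (x - 1 / 3)\<^sup>2" using x \<beta> by (intro power_strict_mono) auto
  then have sq: "\<beta> + 2 / 3 * x < x\<^sup>2" using \<beta> by (simp add: power2_eq_square algebra_simps)
  \<comment> \<open>Bernstein's choice for variance \<open>b\<close> and deviation \<open>x\<close>:
    it keeps \<theta> below 3 and turns the exponent into -\<theta> x / 2, with \<theta> x / 2 = x^2
    / (\<beta> + 2x/3).\<close>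
  define \<theta> where "\<theta> = x / (b + x / 3)"
  have b: "b > 0" using \<beta> by (simp add: b_def)
  have \<theta>: "\<theta> > 0" "\<theta> < 3" using b x0 by (auto simp: \<theta>_def field_simps)
  have "b * (exp \<theta> - 1 - \<theta>) \<le> b * (\<theta>\<^sup>2 / (2 * (1 - \<theta> / 3)))"
    using b \<theta> by (intro mult_left_mono exp_minus_one_le_bernstein) auto
  also have "1 - \<theta> / 3 = b / (b + x / 3)" using b x0 by (simp add: \<theta>_def field_simps)
  also have "b * (\<theta>\<^sup>2 / (2 * (b / (b + x / 3)))) = \<theta> * (\<theta> * (b + x / 3)) / 2"
    using b x0 by (simp add: power2_eq_square)
  also have "\<theta> * (b + x / 3) = x" using b x0 by (simp add: \<theta>_def)
  finally have "b * (exp \<theta> - 1 - \<theta>) \<le> \<theta> * x / 2" .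
  moreover have "\<beta> / 2 * (exp \<theta> - 1) - \<theta> * (\<alpha> / 26) = b * (exp \<theta> - 1 - \<theta>) - \<theta> * x"
    by (simp add: b_def x_def right_diff_distrib left_diff_distrib)
  ultimately have "\<beta> / 2 * (exp \<theta> - 1) - \<theta> * (\<alpha> / 26) \<le> - (\<theta> * x / 2)" by linarith
  moreover have "\<theta> * x / 2 > 1" using sq b x0 by (simp add: \<theta>_def b_def power2_eq_square field_simps)
  ultimately show ?thesis using \<theta>(1) that by blast
qed

theorem theorem4p5:
  fixes \<alpha> \<beta> :: real
    and M :: "nat \<Rightarrow> 'a measure"
    and W :: "nat \<Rightarrow> 'a \<Rightarrow> real mat"
    and \<Gamma> :: "nat \<Rightarrow> nat \<Rightarrow> nat set"
  assumes "\<alpha> > 0" and "\<beta> > 0"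
    and "\<alpha> > 26 * (1 / 3 + \<beta> / 2 + sqrt (1 / 9 + \<beta>))"
    and "\<forall>\<^sub>F n in sequentially.
           stochastic_block_model n (\<Gamma> n)
             (\<alpha> * ln (real (2 * n)) / real (2 * n)) (\<beta> * ln (real (2 * n)) / real (2 * n))
             (M n) (W n)"
  shows "(\<lambda>n. measure (M n) {\<omega> \<in> space (M n). rcut_recovers (2 * n) 2 (W n \<omega>) (\<Gamma> n)})
           \<longlonglongrightarrow> 1"
proof -
  obtain \<theta> g where \<theta>: "\<theta> > 0" and g: "g > 1" "\<beta> / 2 * (exp \<theta> - 1) - \<theta> * (\<alpha> / 26) \<le> - g"
    using bernstein_exponent[OF assms(2,3)] .
  \<comment> \<open>The inner degree tails are exp (-np/5) = N^(-\<alpha>/10) up to a constant, so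
    beating the union over vertices means \<alpha> > 10.\<close>
  have \<alpha>10: "\<alpha> > 10"
  proof -
    have "1 / 3 \<le> sqrt (1 / 9 + \<beta>)" using assms(2) by (intro real_le_rsqrt) (simp add: power2_eq_square)
    then show ?thesis using assms(2,3) by (simp add: field_simps)
  qed
  define l where "l = (\<lambda>n. ln (real (2 * n)))"
  define c where "c = 1 - \<alpha> / 10"
  define lower where "lower = (\<lambda>n. 1 - 2 * (exp (3 / 5) * exp (c * l n) + exp (c * l n)
      + exp ((1 - g) * l n) + 2 / (1 + real n)))"
  let ?P = "\<lambda>n. measure (M n) {\<omega> \<in> space (M n). rcut_recovers (2 * n) 2 (W n \<omega>) (\<Gamma> n)}"
  have l_top: "filterlim l at_top sequentially" unfolding l_def by real_asymp
  have decay: "(\<lambda>n. exp (a * l n)) \<longlonglongrightarrow> 0" if "a < 0" for a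
    by (rule filterlim_compose[OF exp_at_bot])
      (rule filterlim_tendsto_neg_mult_at_bot[OF tendsto_const that l_top])
  have "(\<lambda>n. 2 / (1 + real n)) \<longlonglongrightarrow> 0" by real_asymp
  then have "lower \<longlonglongrightarrow> 1 - 2 * (exp (3 / 5) * 0 + 0 + 0 + 0)"
    unfolding lower_def using decay[of c] decay[of "1 - g"] \<alpha>10 g(1)
    by (intro tendsto_intros) (auto simp: c_def)
  then have lower_lim: "lower \<longlonglongrightarrow> 1" by simp
  \<comment> \<open>The required constant is huge but fixed, while np = (\<alpha>/2) log N tends to
    infinity.\<close>
  have large: "\<forall>\<^sub>F n in sequentially. 2 * (30000 * (3 + 2 * ln 30000)) + 3 \<le> (1 / 10000)\<^sup>2 / 4 * (\<alpha> / 2 * l n)"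
  proof -
    have "filterlim (\<lambda>n. (1 / 10000)\<^sup>2 / 4 * (\<alpha> / 2) * l n) at_top sequentially"
      using assms(1) by (intro filterlim_tendsto_pos_mult_at_top[OF tendsto_const _ l_top]) simp
    then have "\<forall>\<^sub>F n in sequentially. 2 * (30000 * (3 + 2 * ln 30000)) + 3 \<le> (1 / 10000)\<^sup>2 / 4 * (\<alpha> / 2) * l n"
      unfolding filterlim_at_top by blast
    then show ?thesis by (simp add: mult.assoc)
  qed
  have "\<forall>\<^sub>F n in sequentially. lower n \<le> ?P n"
    using assms(4) large eventually_gt_at_top[of 0]
  proof eventually_elim
    case (elim n)
    have mono: "1 - 2 * (a' + b' + c' + d) \<le> P"
      if "1 - 2 * (a + b + c + d) \<le> P" "a \<le> a'" "b \<le> b'" "c \<le> c'" for a b c a' b' c' d P :: real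
      using that by simp
    define p q T where "p = \<alpha> * l n / real (2 * n)" and "q = \<beta> * l n / real (2 * n)"
      and "T = \<alpha> / 26 * l n"
    have l0: "l n > 0" unfolding l_def using \<open>0 < n\<close> by (intro ln_gt_zero) simp
    have np: "n * p = \<alpha> / 2 * l n" "n * q = \<beta> / 2 * l n" using \<open>0 < n\<close> by (simp_all add: p_def q_def)
    \<comment> \<open>As \<open>n\<close> is at most N = exp (l n), the vertices of a block cost one
      unit in the exponent.\<close>
    have n_exp: "n * exp (a * l n) \<le> exp ((1 + a) * l n)" for a
    proof -
      have "real n \<le> exp (l n)" using \<open>0 < n\<close> by (simp add: l_def)
      then show ?thesis by (simp add: distrib_right exp_add mult_right_mono)
    qed
    have "1 - 2 * (n * exp (3 / 5 - n * p / 5) + n * exp (- (n * p) / 5)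
      + n * exp (n * q * (exp \<theta> - 1) - \<theta> * T) + 2 / (1 + real n)) \<le> ?P n"
    proof (rule prob_recovery_lower_bound_sbm)
      show "stochastic_block_model n (\<Gamma> n) p q (M n) (W n)"
        using elim(1) by (simp add: p_def q_def l_def)
      have "\<alpha> * l n > 0" using assms(1) l0 by simp
      \<comment> \<open>In units of \<alpha> log N this is 4/26 < 4/25.\<close>
      then show "4 * T < 8 / 25 * (n * p)" unfolding np T_def by simp
    qed (use elim(2,3) \<theta> in \<open>simp_all only: np\<close>)
    moreover have "n * exp (3 / 5 - n * p / 5) \<le> exp (3 / 5) * exp (c * l n)"
    proof -
      have "n * exp (3 / 5 - n * p / 5) = exp (3 / 5) * (n * exp (- \<alpha> / 10 * l n))"
        unfolding np by (simp add: exp_add[symmetric] mult.left_commute)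
      also have "\<dots> \<le> exp (3 / 5) * exp (c * l n)"
        using n_exp[of "- \<alpha> / 10"] by (intro mult_left_mono) (simp_all add: c_def)
      finally show ?thesis .
    qed
    moreover have "n * exp (- (n * p) / 5) \<le> exp (c * l n)"
      using n_exp[of "- \<alpha> / 10"] unfolding np by (simp add: c_def)
    moreover have "n * exp (n * q * (exp \<theta> - 1) - \<theta> * T) \<le> exp ((1 - g) * l n)"
    proof -
      have "n * q * (exp \<theta> - 1) - \<theta> * T = (\<beta> / 2 * (exp \<theta> - 1) - \<theta> * (\<alpha> / 26)) * l n"
        unfolding np T_def by (simp add: algebra_simps)
      also have "\<dots> \<le> - g * l n" using g(2) l0 by (intro mult_right_mono) auto
      finally have "n * exp (n * q * (exp \<theta> - 1) - \<theta> * T) \<le> n * exp (- g * l n)"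
        by (intro mult_left_mono) simp_all
      also have "\<dots> \<le> exp ((1 - g) * l n)" using n_exp[of "- g"] by simp
      finally show ?thesis .
    qed
    ultimately show "lower n \<le> ?P n" unfolding lower_def by (rule mono)
  qed
  moreover have "\<forall>\<^sub>F n in sequentially. ?P n \<le> 1"
    using assms(4)
  proof eventually_elim
    case (elim n)
    then have "prob_space (M n)" unfolding stochastic_block_model_def by (rule conjunct1)
    then show ?case by (rule prob_space.prob_le_1)
  qed
  ultimately show ?thesis
    by (rule tendsto_sandwich[OF _ _ lower_lim tendsto_const])
qed

end
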